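(* Assume $(E,\|\cdot\|_E)$ is of Rademacher type $p\in[1,2]$, let $k\in\mathbb{N}$, $q\in(1,\infty)\cap[p,\infty)$, $X\in L^k(\Omega;E)$, $\bar q:=\min\{q,2\}$. Let $(E_\ell)_{\ell\in\mathbb{N}}$ be subspaces of $E$ of dimension $N_\ell<\infty$ satisfying the growth-of-type-constants assumption with constants $a_0,a_1\ge0$, $C_\tau\ge1$. For each $\ell$ let $(X_{\ell,j})_{j}$ be independent copies of $X_\ell\in L^{kq}(\Omega;E_\ell)$ such that, for $\alpha,C_\alpha,C_{\mathsf{stab}}\in(0,\infty)$, $$\sup_\ell N_\ell^\alpha\|\mathbb{M}^k_\varepsilon[X]-\mathbb{M}^k_\varepsilon[X_\ell]\|_{\varepsilon_s}\le C_\alpha,\qquad\sup_\ell\|X_\ell\|^k_{L^{kq}(\Omega;E)}\le C_{\mathsf{stab}}.$$ Assume the cost $\mathcal{C}_\ell$ of one sample of $\otimes^kX_\ell$ satisfies $\mathcal{C}_\ell\le C_\gamma N_\ell^\gamma$ ($\gamma,C_\gamma>0$) and $N_\ell\eqsim A^\ell$ for some $A>1$. Then for every $\epsilon\in(0,1/2]$ there are $L,M_L\in\mathbb{N}$ with $$\Big\|\mathbb{M}^k_\varepsilon[X]-\frac1{M_L}\sum_{j=1}^{M_L}\otimes^kX_{L,j}\Big\|_{L^q(\Omega;\otimes^{k,s}_{\varepsilon_s}E)}<\epsilon$$ at cost $M_L\mathcal{C}_L\lesssim\epsilon^{-\gamma/\alpha}+\epsilon^{-\bar q'-\frac{\gamma+a_0-a_1\bar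 q'}{\alpha}}$ if $\alpha\ge a_1$, and $\lesssim\epsilon^{-\gamma/\alpha}+\epsilon^{-p'-\frac{\gamma+a_0-a_1p'}{\alpha}}$ if $\alpha<a_1$ and $p\in(1,2]$ (implicit constants independent of $\epsilon$).
   Context: $r'$ is the Hölder conjugate. $\otimes^kx:=x\otimes\cdots\otimes x$. Injective norm on $\otimes^kE$: $\|\sum_jx_{j,1}\otimes\cdots\otimes x_{j,k}\|_\varepsilon:=\sup_{f_i\in B_{E'}}|\sum_j\prod_if_i(x_{j,i})|$; for $Y\in L^k(\Omega;E)$, $\mathbb{M}^k_\varepsilon[Y]:=\mathbb{E}[\otimes^kY]$ (Bochner integral in the completion). $\otimes^{k,s}_{\varepsilon_s}E$ is the completion of $\mathrm{span}\{\otimes^kx\}$ under $\|\sum_j\lambda_j\otimes^kx_j\|_{\varepsilon_s}:=\sup_{f\in B_{E'}}|\sum_j\lambda_jf(x_j)^k|$; moments lie in it. Rademacher type $r$ and constant $\tau_r(F)$: least $\tau$ with $(\mathbb{E}\|\sum_jr_jx_j\|_F^r)^{1/r}\le\tau(\sum_j\|x_j\|^r_F)^{1/r}$ for all Rademacher families and finite families; $\tau_r(E_\ell)$ uses the norm of $E$. Growth-of-type-constants assumption: $\sup_\ell\sup_{r\in[p,2]\cap(1,2]}N_\ell^{-(a_0-a_1r')}[\tau_r(E_\ell)]^{r'}\le C_\tau$. *)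

theory Defs
  imports "HOL-Analysis.Analysis" "HOL-Probability.Probability"
begin

text \<open>Hoelder conjugate exponent r' = r/(r-1) (used only for r > 1).\<close>
definition hconj :: "real \<Rightarrow> real" where
  "hconj r = r / (r - 1)"

definition dual_ball :: "('a::real_normed_vector \<Rightarrow> real) set" where
  "dual_ball = {f. bounded_linear f \<and> onorm f \<le> 1}"

text \<open>Rademacher type inequality with constant tau on vectors from S:
  (E || sum_j r_j x_j ||^r)^(1/r) <= tau (sum_j ||x_j||^r)^(1/r), the expectation over a
  Rademacher family being the uniform average over all sign vectors.\<close>
definition rad_type_ineq :: "'a::real_normed_vector set \<Rightarrow> real \<Rightarrow> real \<Rightarrow> bool" where
  "rad_type_ineq S r \<tau> \<longleftrightarrow> 0 \<le> \<tau> \<and>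
     (\<forall>(n::nat) (x::nat \<Rightarrow> 'a). (\<forall>j<n. x j \<in> S) \<longrightarrow>
        ((\<Sum>s\<in>({..<n} \<rightarrow>\<^sub>E {-1::real, 1}). norm (\<Sum>j<n. s j *\<^sub>R x j) powr r) / 2 ^ n) powr (1 / r)
        \<le> \<tau> * (\<Sum>j<n. norm (x j) powr r) powr (1 / r))"

definition has_rad_type :: "'a::real_normed_vector set \<Rightarrow> real \<Rightarrow> bool" where
  "has_rad_type S r \<longleftrightarrow> (\<exists>\<tau>. rad_type_ineq S r \<tau>)"

definition rad_type_const :: "'a::real_normed_vector set \<Rightarrow> real \<Rightarrow> real" where
  "rad_type_const S r = Inf {\<tau>. rad_type_ineq S r \<tau>}"

text \<open>Symmetric injective norm of the difference of k-th moments of X and Y,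
  || M^k[X] - M^k[Y] ||_{eps_s} = sup_{f in B_E'} | E f(X)^k - E f(Y)^k |.\<close>
definition moment_dist ::
  "'w measure \<Rightarrow> nat \<Rightarrow> ('w \<Rightarrow> 'a::real_normed_vector) \<Rightarrow> ('w \<Rightarrow> 'a) \<Rightarrow> ennreal" where
  "moment_dist M k X Y =
     (SUP f\<in>dual_ball. ennreal \<bar>(\<integral>w. (f (X w)) ^ k \<partial>M) - (\<integral>w. (f (Y w)) ^ k \<partial>M)\<bar>)"

text \<open>Pointwise symmetric injective norm of M^k[X] - (1/m) sum_{j=1}^m (x)^{tensor k} (Z j w).\<close>
definition mc_error ::
  "'w measure \<Rightarrow> nat \<Rightarrow> ('w \<Rightarrow> 'a::real_normed_vector) \<Rightarrow> (nat \<Rightarrow> 'w \<Rightarrow> 'a) \<Rightarrow> nat \<Rightarrow> 'w \<Rightarrow> ennreal" where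
  "mc_error M k X Z m w =
     (SUP f\<in>dual_ball. ennreal \<bar>(\<integral>v. (f (X v)) ^ k \<partial>M) - (\<Sum>j=1..m. (f (Z j w)) ^ k) / real m\<bar>)"

definition Lq_pow :: "'w measure \<Rightarrow> real \<Rightarrow> ('w \<Rightarrow> ennreal) \<Rightarrow> ennreal" where
  "Lq_pow M q g = (\<integral>\<^sup>+ w. (if g w = \<top> then \<top> else ennreal ((enn2real (g w)) powr q)) \<partial>M)"

end

theory Submission
  imports Defs
begin


text \<open>
  The error splits into the bias, controlled by the assumption on the moments, and the sampling
  error sup_f |E f(Y)^k - (1/m) sum_j f(Y_j)^k|. On a finite-dimensional subspace the supremum may
  be taken over a countable set of functionals, and symmetrization, one coordinate at a time, bounds
  its q-th moment by that of sup_f |2 sum_j s_j f(Y_j)^k| / m with independent random signs s_j. For fixed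
  sample points, the contraction principle linearises t^k at the cost of a Lipschitz factor, so that
  the type inequality bounds the mean over the signs by k tau S with S = (sum_j |Y_j|^{kr})^{1/r}.
  The supremum changes by at most 2 |Y_j|^k when one sign is flipped and, as r is at most 2, the l^2 norm of
  these increments is at most 2 S; concentration therefore upgrades the mean to a q-th moment,
  which replaces the Kahane-Khintchine inequality. Hence the sampling error in L^q is of order
  tau m^{-1/r'} for every admissible r, and both cost bounds follow by balancing it with the bias.
\<close>

section \<open>Averages over random signs\<close>

text \<open>The contraction principle compares means only, so linearising the powers yields no more
  than the mean over the signs; the passage to the q-th moment has to come afterwards, on the
  supremum itself. It costs nothing in the rate: mean and flip increments are governed by the same
  S, and since the deviation term carries no type constant, \<open>1 \<le> \<tau>\<close> absorbs it
  into \<open>\<tau> * S\<close>. The constant in front depends on k and q alone, hence not on the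
  level.

  E is not assumed separable. Suprema over the dual ball and sums of random vectors are therefore
  never treated as measurable: the integrands are built from scalar functions of single samples, and
  the true error is bounded almost everywhere by a measurable majorant. \<open>nn_integral\<close>
  is a supremum over simple functions below the integrand, hence monotone for arbitrary functions;
  additivity is used for the majorant only.\<close>

text \<open>The coordinates from n on are set to 0, where sums of n sign multiples do not see them.\<close>

primrec ravg :: "nat \<Rightarrow> ((nat \<Rightarrow> real) \<Rightarrow> 'b::{plus,inverse,numeral}) \<Rightarrow> 'b" where
  "ravg 0 g = g (\<lambda>_. 0)"
| "ravg (Suc n) g = (ravg n (\<lambda>s. g (s(n := 1))) + ravg n (\<lambda>s. g (s(n := -1)))) / 2"

text \<open>The type inequality sums over extensional functions, which are \<open>undefined\<close>
  from n on, whereas \<open>ravg\<close> fills in 0; that \<open>g\<close> ignores these coordinates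
  reconciles the two. The recursion then matches the insertion of n into the index set.\<close>

lemma ravg_eq_sum_signs:
  fixes g :: "(nat \<Rightarrow> real) \<Rightarrow> real"
  assumes "\<And>s t. (\<And>j. j < n \<Longrightarrow> s j = t j) \<Longrightarrow> g s = g t"
  shows "ravg n g = (\<Sum>s\<in>({..<n} \<rightarrow>\<^sub>E {-1::real, 1}). g s) / 2 ^ n"
  using assms
proof (induction n arbitrary: g)
  case 0
  show ?case using 0[of "\<lambda>_. 0" "\<lambda>_. undefined"] by simp
next
  case (Suc n)
  let ?P = "\<lambda>n. {..<n} \<rightarrow>\<^sub>E {-1::real, 1}"
  have inj: "inj_on (\<lambda>(y, s). s(n := y)) ({-1::real,1} \<times> ?P n)"
    by (rule inj_combinator) simp
  have "(\<Sum>s\<in>?P (Suc n). g s) = (\<Sum>(y,s)\<in>{-1::real,1} \<times> ?P n. g (s(n := y)))"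
    unfolding lessThan_Suc PiE_insert_eq using sum.reindex[OF inj, of g]
    by (simp add: case_prod_beta o_def)
  also have "\<dots> = (\<Sum>y\<in>{-1::real,1}. \<Sum>s\<in>?P n. g (s(n := y)))"
    by (rule sum.cartesian_product[symmetric])
  also have "\<dots> = (\<Sum>s\<in>?P n. g (s(n := -1))) + (\<Sum>s\<in>?P n. g (s(n := 1)))" by simp
  finally have e: "(\<Sum>s\<in>?P (Suc n). g s) = \<dots>" .
  have "ravg n (\<lambda>s. g (s(n := y))) = (\<Sum>s\<in>?P n. g (s(n := y))) / 2 ^ n" for y
    by (rule Suc.IH, rule Suc.prems) (auto simp: less_Suc_eq)
  then show ?case unfolding e ravg.simps by (simp add: field_simps)
qed

lemma ravg_mono:
  fixes g h :: "(nat \<Rightarrow> real) \<Rightarrow> real"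
  assumes "\<And>s. g s \<le> h s"
  shows "ravg n g \<le> ravg n h"
  using assms by (induction n arbitrary: g h) (simp_all add: add_mono divide_right_mono)

lemma ravg_mono_ennreal:
  fixes g h :: "(nat \<Rightarrow> real) \<Rightarrow> ennreal"
  assumes "\<And>s. g s \<le> h s"
  shows "ravg n g \<le> ravg n h"
  using assms by (induction n arbitrary: g h) (simp_all add: add_mono divide_right_mono_ennreal)

lemma ravg_nonneg:
  fixes g :: "(nat \<Rightarrow> real) \<Rightarrow> real"
  assumes "\<And>s. 0 \<le> g s"
  shows "0 \<le> ravg n g"
  using assms by (induction n arbitrary: g) simp_all

lemma ravg_add:
  fixes g h :: "(nat \<Rightarrow> real) \<Rightarrow> real"
  shows "ravg n (\<lambda>s. g s + h s) = ravg n g + ravg n h"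
  by (induction n arbitrary: g h) (simp_all add: field_simps)

lemma ravg_cmult:
  fixes g :: "(nat \<Rightarrow> real) \<Rightarrow> real"
  shows "ravg n (\<lambda>s. c * g s) = c * ravg n g"
  by (induction n arbitrary: g) (simp_all add: field_simps)

lemma ravg_const [simp]: "ravg n (\<lambda>s. c::real) = c"
  by (induction n) simp_all

lemma ennreal_mean: "0 \<le> a \<Longrightarrow> 0 \<le> b \<Longrightarrow> ennreal ((a + b) / 2) = (ennreal a + ennreal b) / 2"
  by (simp add: divide_ennreal[symmetric] ennreal_plus[symmetric] del: ennreal_plus)

lemma ravg_ennreal:
  assumes "\<And>s. 0 \<le> g s"
  shows "ravg n (\<lambda>s. ennreal (g s)) = ennreal (ravg n g)"
  using assms by (induction n arbitrary: g) (simp_all add: ravg_nonneg ennreal_mean)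

text \<open>Flipping every sign swaps the two halves of the average at each coordinate. This later
  gives a sign sum and its negative the same average when an absolute value is split.\<close>

lemma ravg_uminus:
  fixes g :: "(nat \<Rightarrow> real) \<Rightarrow> real"
  shows "ravg n (\<lambda>s. g (\<lambda>j. - s j)) = ravg n g"
proof (induction n arbitrary: g)
  case (Suc n)
  have "(\<lambda>j. - (s(n := y)) j) = (\<lambda>j. - s j)(n := - y)" for s :: "nat \<Rightarrow> real" and y
    by auto
  then show ?case
    using Suc[of "\<lambda>s. g (s(n := 1))"] Suc[of "\<lambda>s. g (s(n := -1))"] by (simp add: add.commute)
qed simp

section \<open>Convexity of powers and power means\<close>

lemma convex_on_powr_nonneg:
  assumes "1 \<le> q"
  shows "convex_on {0..} (\<lambda>x::real. x powr q)"
proof (rule convex_onI)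
  fix t x y :: real
  assume t: "0 < t" "t < 1" and xy: "x \<in> {0..}" "y \<in> {0..}"
  \<comment> \<open>With one endpoint at 0, convexity reduces to \<open>c powr q \<le> c\<close> for
    0 < c < 1, which holds because 1 <= q.\<close>
  have *: "(c * z) powr q \<le> c * z powr q" if "0 < c" "c < 1" "0 \<le> z" for c z :: real
  proof -
    have "c powr q \<le> c powr 1" using that assms by (intro powr_mono') auto
    then show ?thesis using that by (simp add: powr_mult mult_right_mono)
  qed
  consider "x = 0" | "y = 0" | "0 < x" "0 < y" using xy by fastforce
  then show "((1 - t) *\<^sub>R x + t *\<^sub>R y) powr q \<le> (1 - t) * x powr q + t * y powr q"
  proof cases
    case 1 then show ?thesis using *[of t y] t xy assms by simp
  next
    case 2 then show ?thesis using *[of "1-t" x] t xy assms by simp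
  next
    case 3
    then show ?thesis
      using convex_onD[OF powr_convex[OF assms], of t x y] t by simp
  qed
qed auto

lemma convex_on_abs_powr:
  assumes "1 \<le> q"
  shows "convex_on UNIV (\<lambda>x::real. \<bar>x\<bar> powr q)"
proof (rule convex_onI)
  fix t x y :: real
  assume t: "0 < t" "t < 1"
  have "\<bar>(1 - t) *\<^sub>R x + t *\<^sub>R y\<bar> \<le> (1 - t) * \<bar>x\<bar> + t * \<bar>y\<bar>"
    using t abs_triangle_ineq[of "(1-t)*x" "t*y"] by (simp add: abs_mult)
  then have "\<bar>(1 - t) *\<^sub>R x + t *\<^sub>R y\<bar> powr q \<le> ((1 - t) * \<bar>x\<bar> + t * \<bar>y\<bar>) powr q"
    using assms by (intro powr_mono2) auto
  also have "\<dots> \<le> (1 - t) * \<bar>x\<bar> powr q + t * \<bar>y\<bar> powr q"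
    using convex_onD[OF convex_on_powr_nonneg[OF assms], of t "\<bar>x\<bar>" "\<bar>y\<bar>"] t by simp
  finally show "\<bar>(1 - t) *\<^sub>R x + t *\<^sub>R y\<bar> powr q \<le> (1 - t) * \<bar>x\<bar> powr q + t * \<bar>y\<bar> powr q" .
qed auto

lemma abs_mean_powr_le:
  fixes a b q :: real
  assumes "1 \<le> q"
  shows "\<bar>(a + b) / 2\<bar> powr q \<le> (\<bar>a\<bar> powr q + \<bar>b\<bar> powr q) / 2"
  using convex_onD[OF convex_on_abs_powr[OF assms], of "1/2" a b] by (simp add: field_simps)

text \<open>Jensen's inequality, obtained from two-point convexity applied to the two halves at
  every coordinate.\<close>

lemma ravg_power_mean:
  fixes g :: "(nat \<Rightarrow> real) \<Rightarrow> real"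
  assumes "1 \<le> r" "\<And>s. 0 \<le> g s"
  shows "ravg n g powr r \<le> ravg n (\<lambda>s. g s powr r)"
  using assms(2)
proof (induction n arbitrary: g)
  case (Suc n)
  have nn: "0 \<le> ravg n (\<lambda>s. g (s(n := y)))" for y by (intro ravg_nonneg Suc.prems)
  have "ravg (Suc n) g powr r
      \<le> (ravg n (\<lambda>s. g (s(n := 1))) powr r + ravg n (\<lambda>s. g (s(n := -1))) powr r) / 2"
    using abs_mean_powr_le[OF assms(1), of "ravg n (\<lambda>s. g (s(n := 1)))" "ravg n (\<lambda>s. g (s(n := -1)))"]
      nn[of 1] nn[of "-1"] by simp
  also have "\<dots> \<le> ravg (Suc n) (\<lambda>s. g s powr r)"
    unfolding ravg.simps by (intro divide_right_mono add_mono Suc.IH Suc.prems) simp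
  finally show ?case .
qed simp

section \<open>Concentration for functions of random signs\<close>

text \<open>The sharp exponent is half of this, but the constant is immaterial and this form is
  elementary: up to 1 both exponentials lie below quadratic polynomials, for exp(-t) because (1 +
  t)(1 - t + t^2) = 1 + t^3; beyond 1 one has t <= t^2.\<close>

lemma cosh_le_exp_square: "(exp x + exp (- x)) / 2 \<le> exp (x\<^sup>2)" for x :: real
proof -
  have *: "exp t + exp (- t) \<le> 2 * exp (t\<^sup>2)" if "0 \<le> t" for t :: real
  proof (cases "t \<le> 1")
    case True
    have a: "exp t \<le> 1 + t + t\<^sup>2" using exp_bound[of t] that True by simp
    have "exp (- t) \<le> 1 - t + t\<^sup>2"
    proof -
      have "(1 + t) * (1 - t + t\<^sup>2) = 1 + t ^ 3" by (simp add: algebra_simps power2_eq_square power3_eq_cube)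
      then have "1 \<le> (1 + t) * (1 - t + t\<^sup>2)" using that by simp
      also have "\<dots> \<le> exp t * (1 - t + t\<^sup>2)"
        using True that by (intro mult_right_mono exp_ge_add_one_self) auto
      finally show ?thesis by (simp add: exp_minus field_simps)
    qed
    with a have "exp t + exp (- t) \<le> 2 * (1 + t\<^sup>2)" by simp
    also have "\<dots> \<le> 2 * exp (t\<^sup>2)" by (intro mult_left_mono exp_ge_add_one_self) simp
    finally show ?thesis .
  next
    case False
    then have "t \<le> t\<^sup>2" by (simp add: power2_eq_square)
    moreover have "- t \<le> t\<^sup>2" using that zero_le_power2[of t] by linarith
    ultimately show ?thesis using add_mono[of "exp t" "exp (t\<^sup>2)" "exp (-t)" "exp (t\<^sup>2)"] by simp
  qed
  show ?thesis using *[of x] *[of "-x"] by (cases "0 \<le> x") auto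
qed

text \<open>The martingale argument behind McDiarmid's inequality. Given the last sign, the
  conditional means \<open>a 1\<close> and \<open>a (-1)\<close> lie at d and -d from the full mean,
  and averaging the flip bound gives |d| <= c n. The last sign thus contributes the factor
  cosh(\<theta> d), while the induction hypothesis bounds the fluctuation around each conditional
  mean.\<close>

lemma ravg_exp_bounded_differences:
  fixes Z :: "(nat \<Rightarrow> real) \<Rightarrow> real"
  assumes "\<And>j s. j < n \<Longrightarrow> \<bar>Z (s(j := 1)) - Z (s(j := -1))\<bar> \<le> 2 * c j"
  shows "ravg n (\<lambda>s. exp (\<theta> * (Z s - ravg n Z))) \<le> exp (\<theta>\<^sup>2 * (\<Sum>j<n. (c j)\<^sup>2))"
  using assms
proof (induction n arbitrary: Z)
  case (Suc n)
  define a where "a y = ravg n (\<lambda>s. Z (s(n := y)))" for y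
  define d where "d = (a 1 - a (-1)) / 2"
  have m: "ravg (Suc n) Z = (a 1 + a (-1)) / 2" by (simp add: a_def)
  have "\<bar>a 1 - a (-1)\<bar> = \<bar>ravg n (\<lambda>s. Z (s(n := 1)) - Z (s(n := -1)))\<bar>"
    using ravg_add[of n "\<lambda>s. Z (s(n := 1))" "\<lambda>s. - 1 * Z (s(n := -1))"]
      ravg_cmult[of n "-1" "\<lambda>s. Z (s(n := -1))"] by (simp add: a_def)
  also have "\<dots> \<le> 2 * c n"
  proof (rule abs_leI)
    have b: "Z (s(n := 1)) - Z (s(n := -1)) \<le> 2 * c n" "- (2 * c n) \<le> Z (s(n := 1)) - Z (s(n := -1))" for s
      using Suc.prems[of n s] by linarith+
    show "ravg n (\<lambda>s. Z (s(n := 1)) - Z (s(n := -1))) \<le> 2 * c n"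
      using ravg_mono[OF b(1), of n] by simp
    show "- ravg n (\<lambda>s. Z (s(n := 1)) - Z (s(n := -1))) \<le> 2 * c n"
      using ravg_mono[of "\<lambda>_. - (2 * c n)" "\<lambda>s. Z (s(n := 1)) - Z (s(n := -1))" n, OF b(2)] by simp
  qed
  finally have "\<bar>d\<bar> \<le> \<bar>c n\<bar>" by (simp add: d_def)
  then have d: "(\<theta> * d)\<^sup>2 \<le> \<theta>\<^sup>2 * (c n)\<^sup>2"
    by (simp add: power_mult_distrib mult_left_mono abs_le_square_iff)
  let ?E = "exp (\<theta>\<^sup>2 * (\<Sum>j<n. (c j)\<^sup>2))"
  have IH: "ravg n (\<lambda>s. exp (\<theta> * (Z (s(n := y)) - a y))) \<le> ?E" for y
    unfolding a_def
  proof (rule Suc.IH)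
    fix j :: nat and s :: "nat \<Rightarrow> real" assume "j < n"
    moreover from this have "s(j := z, n := y) = s(n := y, j := z)" for z
      by (intro fun_upd_twist) simp
    ultimately show "\<bar>Z (s(j := 1, n := y)) - Z (s(j := - 1, n := y))\<bar> \<le> 2 * c j"
      using Suc.prems[of j "s(n := y)"] by (simp del: fun_upd_apply)
  qed
  have split: "ravg n (\<lambda>s. exp (\<theta> * (Z (s(n := y)) - ravg (Suc n) Z)))
      = exp (\<theta> * (a y - ravg (Suc n) Z)) * ravg n (\<lambda>s. exp (\<theta> * (Z (s(n := y)) - a y)))" for y
    unfolding ravg_cmult[symmetric] exp_add[symmetric] by (simp only: distrib_left[symmetric]) simp
  have "ravg (Suc n) (\<lambda>s. exp (\<theta> * (Z s - ravg (Suc n) Z)))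
      = (ravg n (\<lambda>s. exp (\<theta> * (Z (s(n := 1)) - ravg (Suc n) Z)))
        + ravg n (\<lambda>s. exp (\<theta> * (Z (s(n := -1)) - ravg (Suc n) Z)))) / 2"
    by (rule ravg.simps)
  also have "\<dots> \<le> (exp (\<theta> * d) * ?E + exp (- (\<theta> * d)) * ?E) / 2"
  proof -
    have "a 1 - ravg (Suc n) Z = d" "a (-1) - ravg (Suc n) Z = - d"
      unfolding m d_def by (simp_all add: field_simps)
    then show ?thesis unfolding split
      by (intro divide_right_mono add_mono) (auto intro!: mult_left_mono IH)
  qed
  also have "\<dots> = (exp (\<theta> * d) + exp (- (\<theta> * d))) / 2 * ?E" by (simp add: field_simps)
  also have "\<dots> \<le> exp ((\<theta> * d)\<^sup>2) * ?E" by (intro mult_right_mono cosh_le_exp_square) simp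
  also have "\<dots> \<le> exp (\<theta>\<^sup>2 * (c n)\<^sup>2) * ?E" using d by simp
  also have "\<dots> = exp (\<theta>\<^sup>2 * (\<Sum>j<Suc n. (c j)\<^sup>2))" by (simp add: exp_add[symmetric] algebra_simps)
  finally show ?case .
qed simp

text \<open>Exponentiating \<open>ln t \<le> t - 1\<close> at t = u / q. It trades q-th moments for
  exponential ones and is the source of the factors \<open>q powr q\<close>.\<close>

lemma powr_le_exp:
  fixes q u :: real
  assumes "0 < q" "0 \<le> u"
  shows "u powr q \<le> q powr q * exp u"
proof (cases "u = 0")
  case False
  have "ln (u / q) \<le> u / q" using ln_le_minus_one[of "u/q"] assms False by simp
  then have "q * ln (u / q) \<le> u" using assms by (simp add: field_simps)
  then have "(u / q) powr q \<le> exp u" using assms False by (simp add: powr_def)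
  then show ?thesis using assms by (simp add: powr_divide field_simps)
qed (use assms in auto)

lemma add_powr_le:
  fixes a b q :: real
  assumes "0 \<le> a" "0 \<le> b" "0 < q"
  shows "(a + b) powr q \<le> 2 powr q * (a powr q + b powr q)"
proof -
  have "(a + b) powr q \<le> (2 * max a b) powr q" using assms by (intro powr_mono2) auto
  also have "\<dots> = 2 powr q * max a b powr q" using assms by (simp add: powr_mult)
  also have "max a b powr q \<le> a powr q + b powr q" by (simp add: max_def)
  finally show ?thesis by simp
qed

text \<open>Above its mean m, Z is split as m + (Z - m), and the excess is bounded by an exponential
  at rate 1 / \<sigma>; this rate makes the exponent in the concentration bound at most 1, whence
  the constant \<open>exp 1\<close>. Below the mean, Z^q <= m^q already suffices.\<close>

lemma ravg_powr_bounded_differences: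
  fixes Z :: "(nat \<Rightarrow> real) \<Rightarrow> real"
  assumes Z: "\<And>s. 0 \<le> Z s"
    and bd: "\<And>j s. j < n \<Longrightarrow> \<bar>Z (s(j := 1)) - Z (s(j := -1))\<bar> \<le> 2 * c j"
    and \<sigma>: "0 < \<sigma>" "(\<Sum>j<n. (c j)\<^sup>2) \<le> \<sigma>\<^sup>2" and q: "0 < q"
  shows "ravg n (\<lambda>s. Z s powr q) \<le> 2 powr q * (ravg n Z powr q + q powr q * exp 1 * \<sigma> powr q)"
proof -
  define m where "m = ravg n Z"
  have m: "0 \<le> m" unfolding m_def by (intro ravg_nonneg Z)
  have "Z s powr q \<le> 2 powr q * (m powr q + \<sigma> powr q * q powr q * exp (1/\<sigma> * (Z s - m)))" for s
  proof (cases "Z s \<le> m")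
    case True
    then have "Z s powr q \<le> m powr q" using Z q by (intro powr_mono2) auto
    moreover have "1 \<le> 2 powr q" using q by (simp add: ge_one_powr_ge_zero)
    ultimately show ?thesis
      using mult_mono[of 1 "2 powr q" "Z s powr q" "m powr q + \<sigma> powr q * q powr q * exp (1/\<sigma> * (Z s - m))"]
      by (simp add: add_increasing2)
  next
    case False
    have "Z s powr q \<le> 2 powr q * (m powr q + (Z s - m) powr q)"
      using add_powr_le[of m "Z s - m" q] m False q by simp
    also have "(Z s - m) powr q = \<sigma> powr q * ((Z s - m) / \<sigma>) powr q"
      using \<sigma> False by (simp add: powr_divide)
    also have "((Z s - m) / \<sigma>) powr q \<le> q powr q * exp ((Z s - m) / \<sigma>)"
      using \<sigma> False q by (intro powr_le_exp) auto
    finally show ?thesis by (simp add: mult_left_mono mult.assoc)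
  qed
  then have "ravg n (\<lambda>s. Z s powr q)
      \<le> ravg n (\<lambda>s. 2 powr q * (m powr q + \<sigma> powr q * q powr q * exp (1/\<sigma> * (Z s - m))))"
    by (rule ravg_mono)
  also have "\<dots> = 2 powr q * (m powr q + \<sigma> powr q * q powr q * ravg n (\<lambda>s. exp (1/\<sigma> * (Z s - m))))"
    by (simp only: ravg_cmult ravg_add ravg_const)
  also have "\<dots> \<le> 2 powr q * (m powr q + \<sigma> powr q * q powr q * exp 1)"
  proof -
    have "ravg n (\<lambda>s. exp (1/\<sigma> * (Z s - m))) \<le> exp ((1/\<sigma>)\<^sup>2 * (\<Sum>j<n. (c j)\<^sup>2))"
      unfolding m_def by (rule ravg_exp_bounded_differences[OF bd])
    also have "\<dots> \<le> exp 1" using \<sigma> by (simp add: power_divide field_simps)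
    finally show ?thesis by (intro mult_left_mono add_left_mono) auto
  qed
  finally show ?thesis unfolding m_def by (simp add: mult_ac)
qed

section \<open>Contraction principle for suprema of sign sums\<close>

text \<open>For fixed t and u the left side contains b t - b u <= |a t - a u|. Whichever sign a t -
  a u has, t and u can be assigned to the two suprema on the right so that its absolute value
  appears there.\<close>

lemma SUP_contraction_pair:
  fixes h a b :: "'t \<Rightarrow> real"
  assumes T: "T \<noteq> {}"
    and con: "\<And>t u. t \<in> T \<Longrightarrow> u \<in> T \<Longrightarrow> \<bar>b t - b u\<bar> \<le> \<bar>a t - a u\<bar>"
    and bdd: "bdd_above ((\<lambda>t. h t + a t) ` T)" "bdd_above ((\<lambda>t. h t - a t) ` T)"
  shows "(SUP t\<in>T. h t + b t) + (SUP t\<in>T. h t - b t) \<le> (SUP t\<in>T. h t + a t) + (SUP t\<in>T. h t - a t)"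
    (is "_ \<le> ?R")
proof -
  have *: "(h t + b t) + (h u - b u) \<le> ?R" if "t \<in> T" "u \<in> T" for t u
    using cSUP_upper[OF that(1) bdd(1)] cSUP_upper[OF that(2) bdd(1)]
      cSUP_upper[OF that(1) bdd(2)] cSUP_upper[OF that(2) bdd(2)] con[OF that]
    by (auto simp: abs_if split: if_splits)
  have "(SUP t\<in>T. h t + b t) \<le> ?R - (h u - b u)" if "u \<in> T" for u
    using *[OF _ that] by (intro cSUP_least T) (simp add: algebra_simps)
  then have "h u - b u \<le> ?R - (SUP t\<in>T. h t + b t)" if "u \<in> T" for u
    using that by (simp add: algebra_simps)
  then have "(SUP t\<in>T. h t - b t) \<le> ?R - (SUP t\<in>T. h t + b t)"
    by (intro cSUP_least T)
  then show ?thesis by simp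
qed

text \<open>The offset h collects the terms of signs already fixed, so it and its bound H are
  generalised in the induction. The induction hypothesis replaces the first n functions while
  \<open>b n\<close> sits in the offset; the one-coordinate comparison then replaces
  \<open>b n\<close> while the terms \<open>a j\<close> sit there. The bounds A and H keep the real
  suprema finite.\<close>

lemma ravg_contraction:
  fixes a b :: "nat \<Rightarrow> 't \<Rightarrow> real" and h :: "'t \<Rightarrow> real"
  assumes T: "T \<noteq> {}"
    and con: "\<And>j t u. t \<in> T \<Longrightarrow> u \<in> T \<Longrightarrow> \<bar>b j t - b j u\<bar> \<le> \<bar>a j t - a j u\<bar>"
    and bda: "\<And>j t. t \<in> T \<Longrightarrow> \<bar>a j t\<bar> \<le> A j" and bdb: "\<And>j t. t \<in> T \<Longrightarrow> \<bar>b j t\<bar> \<le> A j"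
    and bdh: "\<And>t. t \<in> T \<Longrightarrow> \<bar>h t\<bar> \<le> H"
  shows "ravg n (\<lambda>s. SUP t\<in>T. h t + (\<Sum>j<n. s j * b j t)) \<le> ravg n (\<lambda>s. SUP t\<in>T. h t + (\<Sum>j<n. s j * a j t))"
  using bdh
proof (induction n arbitrary: h H)
  case (Suc n)
  have upd: "(\<Sum>j<n. (s(n := y)) j * f j) = (\<Sum>j<n. s j * f j)" for s y and f :: "nat \<Rightarrow> real"
    by (intro sum.cong) auto
  have IH: "ravg n (\<lambda>s. SUP t\<in>T. (h t + y * b n t) + (\<Sum>j<n. s j * b j t))
      \<le> ravg n (\<lambda>s. SUP t\<in>T. (h t + y * b n t) + (\<Sum>j<n. s j * a j t))" if "\<bar>y\<bar> \<le> 1" for y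
  proof (rule Suc.IH)
    fix t assume "t \<in> T"
    then show "\<bar>h t + y * b n t\<bar> \<le> H + A n"
      using Suc.prems[of t] bdb[of t n] that mult_left_le_one_le[of "\<bar>b n t\<bar>" "\<bar>y\<bar>"]
        abs_triangle_ineq[of "h t" "y * b n t"] by (simp add: abs_mult)
  qed
  have bs: "bdd_above ((\<lambda>t. (h t + (\<Sum>j<n. s j * a j t)) + y * a n t) ` T)" for s y
  proof (rule bdd_aboveI2)
    fix t assume t: "t \<in> T"
    have "(\<Sum>j<n. s j * a j t) \<le> (\<Sum>j<n. \<bar>s j\<bar> * A j)"
      using bda[OF t] by (intro sum_mono) (rule order_trans[OF abs_ge_self], simp add: abs_mult mult_left_mono)
    moreover have "y * a n t \<le> \<bar>y\<bar> * A n"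
      by (rule order_trans[OF abs_ge_self]) (simp add: abs_mult mult_left_mono bda[OF t])
    ultimately show "(h t + (\<Sum>j<n. s j * a j t)) + y * a n t \<le> H + (\<Sum>j<n. \<bar>s j\<bar> * A j) + \<bar>y\<bar> * A n"
      using Suc.prems[OF t] by linarith
  qed
  have "ravg (Suc n) (\<lambda>s. SUP t\<in>T. h t + (\<Sum>j<Suc n. s j * b j t))
      = (ravg n (\<lambda>s. SUP t\<in>T. (h t + 1 * b n t) + (\<Sum>j<n. s j * b j t))
       + ravg n (\<lambda>s. SUP t\<in>T. (h t + (-1) * b n t) + (\<Sum>j<n. s j * b j t))) / 2"
    by (simp add: upd algebra_simps)
  also have "\<dots> \<le> (ravg n (\<lambda>s. SUP t\<in>T. (h t + 1 * b n t) + (\<Sum>j<n. s j * a j t))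
       + ravg n (\<lambda>s. SUP t\<in>T. (h t + (-1) * b n t) + (\<Sum>j<n. s j * a j t))) / 2"
    using IH[of 1] IH[of "-1"] by simp
  also have "\<dots> = ravg n (\<lambda>s. (SUP t\<in>T. (h t + (\<Sum>j<n. s j * a j t)) + b n t)
       + (SUP t\<in>T. (h t + (\<Sum>j<n. s j * a j t)) - b n t)) / 2"
    by (simp add: ravg_add algebra_simps)
  also have "\<dots> \<le> ravg n (\<lambda>s. (SUP t\<in>T. (h t + (\<Sum>j<n. s j * a j t)) + a n t)
       + (SUP t\<in>T. (h t + (\<Sum>j<n. s j * a j t)) - a n t)) / 2"
    using bs[of _ 1] bs[of _ "-1"]
    by (intro divide_right_mono ravg_mono SUP_contraction_pair T con) auto
  also have "\<dots> = ravg (Suc n) (\<lambda>s. SUP t\<in>T. h t + (\<Sum>j<Suc n. s j * a j t))"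
    by (simp add: ravg_add upd algebra_simps)
  finally show ?case .
qed simp


section \<open>Finite-dimensional subspaces\<close>

text \<open>The bound makes coordinates Lipschitz functions of the vector. A convergent sequence in
  the span then has Cauchy coordinates, and their limits are coordinates of the limit.\<close>

lemma closed_span_if_coordinates_bounded:
  fixes B :: "'a::real_normed_vector set"
  assumes B: "finite B" and K: "\<And>c. (\<Sum>b\<in>B. \<bar>c b\<bar>) \<le> K * norm (\<Sum>b\<in>B. c b *\<^sub>R b)"
  shows "closed (span B)"
  unfolding closed_sequential_limits
proof (intro allI impI, elim conjE)
  fix y l assume y: "\<forall>n. y n \<in> span B" and lim: "y \<longlonglongrightarrow> l"
  have "\<forall>n. \<exists>c. y n = (\<Sum>b\<in>B. c b *\<^sub>R b)" using y by (auto simp: span_finite[OF B])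
  then obtain c where c: "\<And>n. y n = (\<Sum>b\<in>B. c n b *\<^sub>R b)" by metis
  have "convergent (\<lambda>n. c n b)" if b: "b \<in> B" for b
  proof -
    \<comment> \<open>K carries no sign condition, hence \<open>\<bar>K\<bar>\<close>; the 1 added
      to it below keeps the divisor of e positive.\<close>
    have le: "\<bar>c m b - c n b\<bar> \<le> \<bar>K\<bar> * norm (y m - y n)" for m n
    proof -
      have "\<bar>c m b - c n b\<bar> \<le> (\<Sum>b\<in>B. \<bar>c m b - c n b\<bar>)"
        using B b by (intro member_le_sum) auto
      also have "\<dots> \<le> K * norm (y m - y n)"
        using K[of "\<lambda>b. c m b - c n b"] by (simp add: c scaleR_left_diff_distrib sum_subtractf)
      also have "\<dots> \<le> \<bar>K\<bar> * norm (y m - y n)" by (intro mult_right_mono) auto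
      finally show ?thesis .
    qed
    have "Cauchy (\<lambda>n. c n b)"
    proof (rule metric_CauchyI)
      fix e :: real assume e: "0 < e"
      have "Cauchy y" using lim by (rule LIMSEQ_imp_Cauchy)
      then obtain N where N: "\<And>m n. N \<le> m \<Longrightarrow> N \<le> n \<Longrightarrow> dist (y m) (y n) < e / (\<bar>K\<bar> + 1)"
        using metric_CauchyD[of y "e / (\<bar>K\<bar> + 1)"] e by auto
      have "dist (c m b) (c n b) < e" if "N \<le> m" "N \<le> n" for m n
      proof -
        have "dist (c m b) (c n b) \<le> \<bar>K\<bar> * norm (y m - y n)" using le[of m n] by (simp add: dist_real_def)
        also have "\<dots> \<le> (\<bar>K\<bar> + 1) * norm (y m - y n)" by (intro mult_right_mono) auto
        also have "\<dots> < e" using N[OF that] by (simp add: dist_norm field_simps)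
        finally show ?thesis .
      qed
      then show "\<exists>M. \<forall>m\<ge>M. \<forall>n\<ge>M. dist (c m b) (c n b) < e" by blast
    qed
    then show ?thesis by (rule Cauchy_convergent)
  qed
  then have "(\<lambda>n. c n b) \<longlonglongrightarrow> lim (\<lambda>n. c n b)" if "b \<in> B" for b
    using that by (simp add: convergent_LIMSEQ_iff)
  then have "y \<longlonglongrightarrow> (\<Sum>b\<in>B. lim (\<lambda>n. c n b) *\<^sub>R b)"
    unfolding c by (intro tendsto_intros)
  with lim have "l = (\<Sum>b\<in>B. lim (\<lambda>n. c n b) *\<^sub>R b)" by (rule LIMSEQ_unique)
  then show "l \<in> span B" by (simp add: span_sum span_scale span_base)
qed

text \<open>Bounded coordinates and closedness are proved alternately, in place of a compactness
  argument: the bound for B makes its span closed, so the new vector a has a positive distance d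
  from it, and d controls the coefficient of a.\<close>

lemma coordinates_bounded:
  fixes B :: "'a::real_normed_vector set"
  assumes "finite B" "independent B"
  shows "\<exists>K\<ge>0. \<forall>c. (\<Sum>b\<in>B. \<bar>c b\<bar>) \<le> K * norm (\<Sum>b\<in>B. c b *\<^sub>R b)"
  using assms
proof (induction B rule: finite_induct)
  case empty
  then show ?case by auto
next
  case (insert a B)
  then have ind: "independent B" and a: "a \<notin> span B"
    using independent_insert[of a B] by auto
  obtain K where K: "0 \<le> K" "\<And>c. (\<Sum>b\<in>B. \<bar>c b\<bar>) \<le> K * norm (\<Sum>b\<in>B. c b *\<^sub>R b)"
    using insert.IH[OF ind] by blast
  have "closed (span B)" by (rule closed_span_if_coordinates_bounded[OF insert.hyps(1) K(2)])
  then obtain d where d: "0 < d" "ball a d \<subseteq> - span B"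
    using a open_contains_ball[of "- span B"] by (auto simp: open_Compl)
  then have d: "0 < d" "\<And>y. y \<in> span B \<Longrightarrow> d \<le> dist a y" by force+
  \<comment> \<open>\<open>1 / d\<close> bounds the coefficient of a; removing the multiple of a
    leaves a vector of norm at most \<open>1 + norm a / d\<close> times the original one, and K
    passes from that norm to its coordinates.\<close>
  define L where "L = 1 / d + K * (1 + norm a / d)"
  have "(\<Sum>b\<in>insert a B. \<bar>c b\<bar>) \<le> L * norm (\<Sum>b\<in>insert a B. c b *\<^sub>R b)" for c
  proof -
    define y where "y = (\<Sum>b\<in>B. c b *\<^sub>R b)"
    define x where "x = c a *\<^sub>R a + y"
    have y: "y \<in> span B" unfolding y_def by (simp add: span_sum span_scale span_base)
    have 1: "\<bar>c a\<bar> \<le> norm x / d"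
    proof (cases "c a = 0")
      case False
      have "d \<le> dist a ((- 1 / c a) *\<^sub>R y)" using y by (intro d span_scale)
      also have "a - (- 1 / c a) *\<^sub>R y = (1 / c a) *\<^sub>R x"
        using False by (simp add: x_def scaleR_add_right)
      then have "dist a ((- 1 / c a) *\<^sub>R y) = norm x / \<bar>c a\<bar>"
        by (simp add: dist_norm divide_inverse)
      finally show ?thesis using False d by (simp add: field_simps)
    qed (use d in auto)
    have "norm y \<le> norm x + \<bar>c a\<bar> * norm a"
      using norm_triangle_ineq4[of x "c a *\<^sub>R a"] by (simp add: x_def)
    also have "\<dots> \<le> norm x + norm x / d * norm a" using 1 by (intro add_left_mono mult_right_mono) auto
    finally have "K * norm y \<le> K * (norm x + norm x / d * norm a)" using K by (intro mult_left_mono)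
    then have "\<bar>c a\<bar> + (\<Sum>b\<in>B. \<bar>c b\<bar>) \<le> norm x / d + K * (norm x + norm x / d * norm a)"
      using 1 K(2)[of c] unfolding y_def by linarith
    also have "\<dots> = L * norm x" unfolding L_def by (simp add: algebra_simps)
    finally show ?thesis using insert.hyps by (simp add: x_def y_def)
  qed
  moreover have "0 \<le> L" using d K by (simp add: L_def)
  ultimately show ?case by blast
qed

lemma obtain_finite_basis:
  fixes V :: "'a::real_normed_vector set"
  assumes "\<exists>B. finite B \<and> V = span B"
  obtains B where "finite B" "independent B" "V = span B"
proof -
  obtain B0 where B0: "finite B0" "V = span B0" using assms by blast
  obtain B where B: "B \<subseteq> B0" "independent B" "B0 \<subseteq> span B" using maximal_independent_subset .
  have "span B0 = span B" using B by (simp add: span_mono span_minimal subset_antisym)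
  then show ?thesis using that B B0 finite_subset by blast
qed

lemma closed_finite_dim:
  fixes V :: "'a::real_normed_vector set"
  assumes "\<exists>B. finite B \<and> V = span B"
  shows "closed V"
proof -
  obtain B where B: "finite B" "independent B" "V = span B" using obtain_finite_basis[OF assms] .
  then obtain K where "\<And>c. (\<Sum>b\<in>B. \<bar>c b\<bar>) \<le> K * norm (\<Sum>b\<in>B. c b *\<^sub>R b)"
    using coordinates_bounded[OF B(1,2)] by blast
  then show ?thesis unfolding B(3) by (rule closed_span_if_coordinates_bounded[OF B(1)])
qed

section \<open>Rademacher type of finite-dimensional spaces\<close>

text \<open>The embedding of l^r into l^2 with constant 1: every term is at most the l^r norm R, so
  a^2 = a^r a^(2-r) <= a^r R^(2-r).\<close>

lemma sum_squares_le_powr: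
  fixes a :: "nat \<Rightarrow> real"
  assumes r: "0 < r" "r \<le> 2" and a: "\<And>j. j < n \<Longrightarrow> 0 \<le> a j"
  shows "(\<Sum>j<n. (a j)\<^sup>2) \<le> ((\<Sum>j<n. a j powr r) powr (1 / r))\<^sup>2"
proof -
  define S where "S = (\<Sum>j<n. a j powr r)"
  define R where "R = S powr (1 / r)"
  have S: "0 \<le> S" unfolding S_def by (simp add: sum_nonneg)
  have Rr: "R powr r = S" using S r by (simp add: R_def powr_powr)
  have "a j \<le> R" if "j < n" for j
  proof -
    have "a j powr r \<le> S" unfolding S_def using that by (intro member_le_sum) auto
    then have "(a j powr r) powr (1 / r) \<le> R" unfolding R_def using r by (intro powr_mono2) auto
    then show ?thesis using a[OF that] r by (simp add: powr_powr)
  qed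
  then have "(a j)\<^sup>2 \<le> a j powr r * R powr (2 - r)" if "j < n" for j
  proof -
    have "(a j)\<^sup>2 = a j powr r * a j powr (2 - r)"
      using a[OF that] by (simp add: powr_add[symmetric])
    also have "\<dots> \<le> a j powr r * R powr (2 - r)"
      using a[OF that] \<open>\<And>j. j < n \<Longrightarrow> a j \<le> R\<close>[OF that] r by (intro mult_left_mono powr_mono2) auto
    finally show ?thesis .
  qed
  then have "(\<Sum>j<n. (a j)\<^sup>2) \<le> (\<Sum>j<n. a j powr r * R powr (2 - r))"
    by (intro sum_mono) auto
  also have "\<dots> = R powr r * R powr (2 - r)" by (simp add: sum_distrib_right[symmetric] Rr S_def)
  also have "\<dots> = R\<^sup>2" by (simp add: powr_add[symmetric] R_def)
  finally show ?thesis by (simp add: R_def S_def)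
qed

text \<open>Orthogonality of the signs: the cross terms cancel between the two values of the last
  sign. The induction moves the term of that sign into the offset z.\<close>

lemma ravg_square:
  fixes t :: "nat \<Rightarrow> real"
  shows "ravg n (\<lambda>s. (z + (\<Sum>j<n. s j * t j))\<^sup>2) = z\<^sup>2 + (\<Sum>j<n. (t j)\<^sup>2)"
proof (induction n arbitrary: z)
  case (Suc n)
  have upd: "(\<Sum>j<n. (s(n := y)) j * t j) = (\<Sum>j<n. s j * t j)" for s y
    by (intro sum.cong) auto
  have "ravg n (\<lambda>s. (z + (\<Sum>j<Suc n. (s(n := y)) j * t j))\<^sup>2)
      = ravg n (\<lambda>s. ((z + y * t n) + (\<Sum>j<n. s j * t j))\<^sup>2)" for y
    unfolding sum.lessThan_Suc upd by (simp add: add_ac)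
  then have "ravg n (\<lambda>s. (z + (\<Sum>j<Suc n. (s(n := y)) j * t j))\<^sup>2)
      = (z + y * t n)\<^sup>2 + (\<Sum>j<n. (t j)\<^sup>2)" for y
    unfolding Suc.IH .
  then show ?case unfolding ravg.simps by (simp only:) (simp add: power2_eq_square algebra_simps)
qed simp

lemma ravg_sum:
  fixes g :: "'i \<Rightarrow> (nat \<Rightarrow> real) \<Rightarrow> real"
  shows "ravg n (\<lambda>s. \<Sum>i\<in>I. g i s) = (\<Sum>i\<in>I. ravg n (g i))"
  by (induction n arbitrary: g) (simp_all add: sum.distrib flip: sum_divide_distrib)

lemma ravg_norm_powr_eq:
  fixes x :: "nat \<Rightarrow> 'a::real_normed_vector"
  shows "(\<Sum>s\<in>({..<n} \<rightarrow>\<^sub>E {-1::real, 1}). norm (\<Sum>j<n. s j *\<^sub>R x j) powr r) / 2 ^ n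
    = ravg n (\<lambda>s. norm (\<Sum>j<n. s j *\<^sub>R x j) powr r)"
proof (rule ravg_eq_sum_signs[symmetric])
  fix s t :: "nat \<Rightarrow> real" assume "\<And>j. j < n \<Longrightarrow> s j = t j"
  then have "(\<Sum>j<n. s j *\<^sub>R x j) = (\<Sum>j<n. t j *\<^sub>R x j)" by (intro sum.cong) auto
  then show "norm (\<Sum>j<n. s j *\<^sub>R x j) powr r = norm (\<Sum>j<n. t j *\<^sub>R x j) powr r" by simp
qed

text \<open>Over a basis, Cauchy-Schwarz reduces the norm to scalar sign sums, where orthogonality
  applies. In the constant, G comes from the norms of the basis vectors and \<open>K\<^sup>2\<close>
  from returning from coordinates to norms.\<close>

lemma ravg_norm_square_finite_dim:
  fixes V :: "'a::real_normed_vector set"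
  assumes "\<exists>B. finite B \<and> V = span B"
  shows "\<exists>C\<ge>0. \<forall>n x. (\<forall>j<n. x j \<in> V) \<longrightarrow>
    ravg n (\<lambda>s. (norm (\<Sum>j<n. s j *\<^sub>R x j))\<^sup>2) \<le> C * (\<Sum>j<n. (norm (x j))\<^sup>2)"
proof -
  obtain B where B: "finite B" "independent B" "V = span B" using obtain_finite_basis[OF assms] .
  then obtain K where K: "0 \<le> K" "\<And>c. (\<Sum>b\<in>B. \<bar>c b\<bar>) \<le> K * norm (\<Sum>b\<in>B. c b *\<^sub>R b)"
    using coordinates_bounded[OF B(1,2)] by blast
  define G where "G = (\<Sum>b\<in>B. (norm b)\<^sup>2)"
  have G: "0 \<le> G" by (simp add: G_def sum_nonneg)
  have "ravg n (\<lambda>s. (norm (\<Sum>j<n. s j *\<^sub>R x j))\<^sup>2) \<le> (G * K\<^sup>2) * (\<Sum>j<n. (norm (x j))\<^sup>2)"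
    if x: "\<forall>j<n. x j \<in> V" for n and x :: "nat \<Rightarrow> 'a"
  proof -
    have "\<forall>j. \<exists>c. j < n \<longrightarrow> x j = (\<Sum>b\<in>B. c b *\<^sub>R b)"
      using x by (auto simp: B(3) span_finite[OF B(1)])
    then obtain c where c: "\<And>j. j < n \<Longrightarrow> x j = (\<Sum>b\<in>B. c j b *\<^sub>R b)" by metis
    have "(norm (\<Sum>j<n. s j *\<^sub>R x j))\<^sup>2 \<le> G * (\<Sum>b\<in>B. (0 + (\<Sum>j<n. s j * c j b))\<^sup>2)" for s
    proof -
      have "(\<Sum>j<n. s j *\<^sub>R x j) = (\<Sum>j<n. \<Sum>b\<in>B. (s j * c j b) *\<^sub>R b)"
        by (intro sum.cong) (simp_all add: c scaleR_sum_right)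
      also have "\<dots> = (\<Sum>b\<in>B. (\<Sum>j<n. s j * c j b) *\<^sub>R b)"
        by (subst sum.swap) (simp add: scaleR_sum_left)
      finally have "norm (\<Sum>j<n. s j *\<^sub>R x j) \<le> (\<Sum>b\<in>B. norm b * \<bar>\<Sum>j<n. s j * c j b\<bar>)"
        using norm_sum[of "\<lambda>b. (\<Sum>j<n. s j * c j b) *\<^sub>R b" B] by (simp add: mult.commute)
      then have "(norm (\<Sum>j<n. s j *\<^sub>R x j))\<^sup>2 \<le> (\<Sum>b\<in>B. norm b * \<bar>\<Sum>j<n. s j * c j b\<bar>)\<^sup>2"
        by (intro power_mono) auto
      also have "\<dots> \<le> (\<Sum>b\<in>B. (norm b)\<^sup>2) * (\<Sum>b\<in>B. \<bar>\<Sum>j<n. s j * c j b\<bar>\<^sup>2)"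
        by (rule Cauchy_Schwarz_ineq_sum)
      finally show ?thesis by (simp add: G_def)
    qed
    then have "ravg n (\<lambda>s. (norm (\<Sum>j<n. s j *\<^sub>R x j))\<^sup>2)
        \<le> ravg n (\<lambda>s. G * (\<Sum>b\<in>B. (0 + (\<Sum>j<n. s j * c j b))\<^sup>2))" by (rule ravg_mono)
    also have "\<dots> = G * (\<Sum>b\<in>B. \<Sum>j<n. (c j b)\<^sup>2)"
      unfolding ravg_cmult ravg_sum ravg_square by simp
    also have "\<dots> = G * (\<Sum>j<n. \<Sum>b\<in>B. \<bar>c j b\<bar>\<^sup>2)" by (subst sum.swap) simp
    also have "\<dots> \<le> G * (\<Sum>j<n. K\<^sup>2 * (norm (x j))\<^sup>2)"
    proof (intro mult_left_mono sum_mono G)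
      fix j assume j: "j \<in> {..<n}"
      have "(\<Sum>b\<in>B. \<bar>c j b\<bar>\<^sup>2) \<le> (\<Sum>b\<in>B. \<bar>c j b\<bar> * (\<Sum>b\<in>B. \<bar>c j b\<bar>))"
        unfolding power2_eq_square using B(1) by (intro sum_mono mult_left_mono member_le_sum) auto
      also have "\<dots> = (\<Sum>b\<in>B. \<bar>c j b\<bar>)\<^sup>2" by (simp add: sum_distrib_right[symmetric] power2_eq_square)
      also have "\<dots> \<le> (K * norm (x j))\<^sup>2"
        using K(2)[of "c j"] c j by (intro power_mono) (auto simp: sum_nonneg)
      finally show "(\<Sum>b\<in>B. \<bar>c j b\<bar>\<^sup>2) \<le> K\<^sup>2 * (norm (x j))\<^sup>2" by (simp add: power_mult_distrib)
    qed
    finally show ?thesis by (simp add: sum_distrib_left[symmetric] mult_ac)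
  qed
  then show ?thesis using G by (intro exI[of _ "G * K\<^sup>2"]) auto
qed

text \<open>\<open>rad_type_const\<close> is an infimum of admissible constants and is informative
  only if there are any. Type 2 is available in finite dimension; it passes down to r <= 2 because
  the r-th mean over the signs is below the quadratic one, while the l^r norm of the summands is
  above their l^2 norm.\<close>

lemma has_rad_type_finite_dim:
  fixes V :: "'a::real_normed_vector set"
  assumes V: "\<exists>B. finite B \<and> V = span B" and r: "1 \<le> r" "r \<le> 2"
  shows "has_rad_type V r"
proof -
  obtain C where C: "0 \<le> C" and Ci: "\<And>n x. (\<forall>j<n. x j \<in> V) \<Longrightarrow>
    ravg n (\<lambda>s. (norm (\<Sum>j<n. s j *\<^sub>R x j))\<^sup>2) \<le> C * (\<Sum>j<n. (norm (x j))\<^sup>2)"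
    using ravg_norm_square_finite_dim[OF V] by blast
  have "rad_type_ineq V r (sqrt C)"
    unfolding rad_type_ineq_def ravg_norm_powr_eq
  proof (intro conjI allI impI)
    fix n and x :: "nat \<Rightarrow> 'a" assume x: "\<forall>j<n. x j \<in> V"
    let ?g = "\<lambda>s. norm (\<Sum>j<n. s j *\<^sub>R x j)"
    let ?R = "(\<Sum>j<n. norm (x j) powr r) powr (1 / r)"
    define a where "a = ravg n (\<lambda>s. ?g s powr r)"
    have a: "0 \<le> a" unfolding a_def by (rule ravg_nonneg) simp
    have "a powr (2 / r) \<le> ravg n (\<lambda>s. (?g s powr r) powr (2 / r))"
      unfolding a_def using r by (intro ravg_power_mean) auto
    also have "\<dots> = ravg n (\<lambda>s. (?g s)\<^sup>2)" using r by (simp add: powr_powr)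
    also have "\<dots> \<le> C * (\<Sum>j<n. (norm (x j))\<^sup>2)" by (rule Ci[OF x])
    also have "\<dots> \<le> C * ?R\<^sup>2" using r C by (intro mult_left_mono sum_squares_le_powr) auto
    also have "\<dots> = (sqrt C * ?R)\<^sup>2" using C by (simp add: power_mult_distrib)
    finally have "(a powr (1 / r))\<^sup>2 \<le> (sqrt C * ?R)\<^sup>2"
      unfolding power2_eq_square powr_add[symmetric] by simp
    then show "a powr (1 / r) \<le> sqrt C * ?R"
      unfolding a_def by (rule power2_le_imp_le) (use C in simp)
  qed (use C in simp)
  then show ?thesis unfolding has_rad_type_def ..
qed

text \<open>The infimum is attained, as the inequality is closed in the constant: division by the
  right-hand norm sum gives a lower bound for all admissible constants. If that sum vanishes, any
  one of them gives the claim.\<close>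

lemma rad_type_ineq_rad_type_const:
  fixes V :: "'a::real_normed_vector set"
  assumes "has_rad_type V r"
  shows "rad_type_ineq V r (rad_type_const V r)"
proof -
  let ?T = "{\<tau>. rad_type_ineq V r \<tau>}"
  have ne: "?T \<noteq> {}" using assms by (auto simp: has_rad_type_def)
  show ?thesis
    unfolding rad_type_ineq_def
  proof (intro conjI allI impI)
    show "0 \<le> rad_type_const V r"
      unfolding rad_type_const_def by (rule cInf_greatest[OF ne]) (auto simp: rad_type_ineq_def)
    fix n and x :: "nat \<Rightarrow> 'a" assume x: "\<forall>j<n. x j \<in> V"
    let ?l = "((\<Sum>s\<in>({..<n} \<rightarrow>\<^sub>E {-1::real, 1}). norm (\<Sum>j<n. s j *\<^sub>R x j) powr r) / 2 ^ n) powr (1 / r)"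
    let ?R = "(\<Sum>j<n. norm (x j) powr r) powr (1 / r)"
    have le: "?l \<le> \<tau> * ?R" if "\<tau> \<in> ?T" for \<tau> using that x by (auto simp: rad_type_ineq_def)
    show "?l \<le> rad_type_const V r * ?R"
    proof (cases "?R = 0")
      case True
      obtain \<tau> where "\<tau> \<in> ?T" using ne by blast
      then show ?thesis using le[of \<tau>] unfolding True by simp
    next
      case False
      then have R: "0 < ?R" using powr_ge_zero[of "\<Sum>j<n. norm (x j) powr r" "1 / r"] by linarith
      then have "?l / ?R \<le> rad_type_const V r"
        unfolding rad_type_const_def using le by (intro cInf_greatest[OF ne]) (simp add: field_simps)
      then show ?thesis using R by (simp add: field_simps)
    qed
  qed
qed

text \<open>A single nonzero vector tests the inequality, since both sides then contain its
  norm.\<close>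

lemma rad_type_ineq_ge_1:
  assumes "rad_type_ineq V r \<tau>" "x \<in> V" "x \<noteq> 0" "0 < r"
  shows "1 \<le> \<tau>"
proof -
  have "((\<Sum>s\<in>({..<1} \<rightarrow>\<^sub>E {-1::real, 1}). norm (\<Sum>j<1::nat. s j *\<^sub>R x) powr r) / 2 ^ 1) powr (1 / r)
      \<le> \<tau> * (\<Sum>j<1::nat. norm x powr r) powr (1 / r)"
    using assms(1,2) unfolding rad_type_ineq_def by (elim conjE allE[of _ 1] allE[of _ "\<lambda>_. x"]) simp
  then have "ravg 1 (\<lambda>s. norm (\<Sum>j<1::nat. s j *\<^sub>R x) powr r) powr (1 / r)
      \<le> \<tau> * (\<Sum>j<1::nat. norm x powr r) powr (1 / r)"
    unfolding ravg_norm_powr_eq[where n = 1 and x = "\<lambda>_. x" and r = r] .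
  then show ?thesis using assms by (simp add: powr_powr)
qed

section \<open>Functionals in the dual ball\<close>

lemma dual_ball_linear: "f \<in> dual_ball \<Longrightarrow> bounded_linear f"
  by (simp add: dual_ball_def)

lemma dual_ball_le: "f \<in> dual_ball \<Longrightarrow> \<bar>f x\<bar> \<le> norm x"
  using onorm[of f x] mult_right_mono[of "onorm f" 1 "norm x"]
  by (fastforce simp: dual_ball_def)

lemma zero_in_dual_ball: "(\<lambda>_. 0) \<in> dual_ball"
  by (simp add: dual_ball_def onorm_zero bounded_linear_zero)

text \<open>On V a functional is determined by its values on the finite spanning list
  \<open>bs\<close>. Padded with 0, these values map the dual ball into the space of real sequences,
  whose subsets are all separable; a countable dense set of images is pulled back. Convergence of
  coordinates is convergence on \<open>bs\<close>, which linearity extends to V.\<close>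

lemma countable_pointwise_dense_dual_ball:
  fixes V :: "'a::real_normed_vector set"
  assumes "\<exists>B. finite B \<and> V = span B"
  obtains D :: "('a \<Rightarrow> real) set" where "countable D" "D \<subseteq> dual_ball" "D \<noteq> {}"
    "\<And>f. f \<in> dual_ball \<Longrightarrow> \<exists>F. (\<forall>n. F n \<in> D) \<and> (\<forall>x\<in>V. (\<lambda>n::nat. F n x) \<longlonglongrightarrow> f x)"
proof -
  obtain B where B: "finite B" "V = span B" using assms by blast
  then obtain bs where bs: "set bs = B" using finite_list by blast
  define \<phi> where "\<phi> f = (\<lambda>i. if i < length bs then f (bs ! i) else 0 :: real)" for f :: "'a \<Rightarrow> real"
  obtain T where T: "countable T" "T \<subseteq> \<phi> ` dual_ball" "\<phi> ` dual_ball \<subseteq> closure T"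
    by (rule separable)
  then obtain D where D: "countable D" "D \<subseteq> dual_ball" "T = \<phi> ` D"
    using countable_subset_image[of T \<phi> dual_ball] by auto
  have dense: "\<exists>F. (\<forall>n. F n \<in> D) \<and> (\<forall>x\<in>V. (\<lambda>n::nat. F n x) \<longlonglongrightarrow> f x)" if f: "f \<in> dual_ball" for f
  proof -
    have "\<phi> f \<in> closure T" using f T by blast
    then obtain h where h: "\<And>n. h n \<in> T" "h \<longlonglongrightarrow> \<phi> f" unfolding closure_sequential by blast
    then have "\<forall>n. \<exists>F. F \<in> D \<and> h n = \<phi> F" using D by blast
    then obtain F where F: "\<And>n. F n \<in> D" "\<And>n. h n = \<phi> (F n)" by metis
    have coord: "(\<lambda>n. h n i) \<longlonglongrightarrow> \<phi> f i" for i
      using h(2) continuous_on_tendsto_compose[OF continuous_on_product_coordinates[of i], of h "\<phi> f"]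
      by simp
    have b: "(\<lambda>n. F n b) \<longlonglongrightarrow> f b" if "b \<in> B" for b
    proof -
      obtain i where "i < length bs" "b = bs ! i" using \<open>b \<in> B\<close> bs by (metis in_set_conv_nth)
      then show ?thesis using coord[of i] by (simp add: F(2) \<phi>_def)
    qed
    have "(\<lambda>n. F n x) \<longlonglongrightarrow> f x" if "x \<in> V" for x
    proof -
      obtain u where x: "x = (\<Sum>b\<in>B. u b *\<^sub>R b)" using \<open>x \<in> V\<close> B by (auto simp: span_finite)
      have ext: "g x = (\<Sum>b\<in>B. u b * g b)" if "g \<in> dual_ball" for g
        using dual_ball_linear[OF that]
        by (simp add: x linear_sum[OF bounded_linear.linear] linear_cmul[OF bounded_linear.linear])
      have "F n x = (\<Sum>b\<in>B. u b * F n b)" for n using ext F(1) D(2) by blast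
      then show ?thesis using ext[OF f] b by (auto intro!: tendsto_intros)
    qed
    then show ?thesis using F(1) by blast
  qed
  moreover from dense[OF zero_in_dual_ball] have "D \<noteq> {}" by blast
  ultimately show ?thesis using that D by blast
qed


section \<open>Random sign sums of powers of functionals\<close>

text \<open>Jensen's inequality for equal weights. With \<theta> = q / r it turns a power of the l^r
  norm of the samples into a sum of q-th powers, whose expectation is under control.\<close>

lemma powr_sum_le:
  fixes a :: "nat \<Rightarrow> real"
  assumes "1 \<le> \<theta>" "\<And>j. j < n \<Longrightarrow> 0 \<le> a j"
  shows "(\<Sum>j<n. a j) powr \<theta> \<le> real n powr (\<theta> - 1) * (\<Sum>j<n. a j powr \<theta>)"
proof (cases "n = 0")
  case False
  have "(\<Sum>j<n. (1 / real n) *\<^sub>R a j) powr \<theta> \<le> (\<Sum>j<n. (1 / real n) * a j powr \<theta>)"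
    using False assms
    by (intro convex_on_sum[OF _ _ convex_on_powr_nonneg]) auto
  then have "((\<Sum>j<n. a j) / real n) powr \<theta> \<le> (\<Sum>j<n. a j powr \<theta>) / real n"
    by (simp add: sum_divide_distrib)
  then have "(\<Sum>j<n. a j) powr \<theta> / real n powr \<theta> \<le> (\<Sum>j<n. a j powr \<theta>) / real n"
    using False assms by (simp add: powr_divide sum_nonneg)
  then have "(\<Sum>j<n. a j) powr \<theta> \<le> real n powr \<theta> / real n * (\<Sum>j<n. a j powr \<theta>)"
    using False by (simp add: field_simps)
  also have "real n powr \<theta> / real n = real n powr (\<theta> - 1)"
    using False by (simp add: powr_diff)
  finally show ?thesis .
qed simp

lemma abs_power_diff_le:
  fixes u v c :: real
  assumes "\<bar>u\<bar> \<le> c" "\<bar>v\<bar> \<le> c"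
  shows "\<bar>u ^ k - v ^ k\<bar> \<le> real k * c ^ (k - 1) * \<bar>u - v\<bar>"
proof -
  have "\<bar>\<Sum>i<k. v ^ (k - Suc i) * u ^ i\<bar> \<le> (\<Sum>i<k. c ^ (k - 1))"
  proof (rule order_trans[OF sum_abs], rule sum_mono)
    fix i assume i: "i \<in> {..<k}"
    have "\<bar>v ^ (k - Suc i) * u ^ i\<bar> \<le> c ^ (k - Suc i) * c ^ i"
      unfolding abs_mult power_abs using assms by (intro mult_mono power_mono) auto
    also have "\<dots> = c ^ (k - 1)" using i by (simp add: power_add[symmetric])
    finally show "\<bar>v ^ (k - Suc i) * u ^ i\<bar> \<le> c ^ (k - 1)" .
  qed
  then have "\<bar>u - v\<bar> * \<bar>\<Sum>i<k. v ^ (k - Suc i) * u ^ i\<bar> \<le> \<bar>u - v\<bar> * (real k * c ^ (k - 1))"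
    by (intro mult_left_mono) auto
  then show ?thesis unfolding power_diff_sumr2[of u k v] abs_mult by (simp add: mult_ac)
qed

lemma dual_ball_power_le: "f \<in> dual_ball \<Longrightarrow> \<bar>f x ^ k\<bar> \<le> norm x ^ k"
  using dual_ball_le[of f x] by (simp add: power_abs power_mono)

text \<open>No absolute value is taken, because the contraction comparison is for one-sided suprema.
  For \<open>1 \<le> k\<close> the zero functional still makes the value nonnegative, and the
  two-sided supremum is recovered from s and -s.\<close>

definition rad_power_sup :: "nat \<Rightarrow> nat \<Rightarrow> (nat \<Rightarrow> 'a::real_normed_vector) \<Rightarrow> (nat \<Rightarrow> real) \<Rightarrow> real" where
  "rad_power_sup k n x s = (SUP f\<in>dual_ball. \<Sum>j<n. s j * f (x j) ^ k)"

lemma bdd_above_rad_power_sup: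
  "bdd_above ((\<lambda>f. \<Sum>j<n. s j * f (x j) ^ k) ` dual_ball)"
proof (rule bdd_aboveI2)
  fix f :: "'a \<Rightarrow> real" assume f: "f \<in> dual_ball"
  show "(\<Sum>j<n. s j * f (x j) ^ k) \<le> (\<Sum>j<n. \<bar>s j\<bar> * norm (x j) ^ k)"
  proof (intro sum_mono)
    fix j
    have "\<bar>s j * f (x j) ^ k\<bar> \<le> \<bar>s j\<bar> * norm (x j) ^ k"
      unfolding abs_mult by (intro mult_left_mono dual_ball_power_le[OF f]) simp
    then show "s j * f (x j) ^ k \<le> \<bar>s j\<bar> * norm (x j) ^ k" by linarith
  qed
qed

lemma rad_power_sup_upper:
  "f \<in> dual_ball \<Longrightarrow> (\<Sum>j<n. s j * f (x j) ^ k) \<le> rad_power_sup k n x s"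
  unfolding rad_power_sup_def by (rule cSUP_upper[OF _ bdd_above_rad_power_sup])

lemma rad_power_sup_nonneg:
  assumes "1 \<le> k"
  shows "0 \<le> rad_power_sup k n x s"
  using rad_power_sup_upper[OF zero_in_dual_ball, where k = k and n = n and x = x and s = s] assms
  by (simp add: power_0_left)

lemma rad_power_sup_update_le:
  assumes "j < n" "\<bar>y\<bar> \<le> 1" "\<bar>z\<bar> \<le> 1"
  shows "rad_power_sup k n x (s(j := y)) \<le> rad_power_sup k n x (s(j := z)) + 2 * norm (x j) ^ k"
  unfolding rad_power_sup_def[of k n x "s(j := y)"]
proof (rule cSUP_least)
  show "dual_ball \<noteq> ({} :: ('a \<Rightarrow> real) set)" using zero_in_dual_ball by blast
  fix f :: "'a \<Rightarrow> real" assume f: "f \<in> dual_ball"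
  have e: "(\<Sum>i<n. (s(j := t)) i * f (x i) ^ k) = t * f (x j) ^ k + (\<Sum>i\<in>{..<n} - {j}. s i * f (x i) ^ k)" for t
    using assms(1) by (subst sum.remove[of _ j]) (auto intro!: sum.cong)
  have "(y - z) * f (x j) ^ k \<le> 2 * norm (x j) ^ k"
  proof (rule order_trans[OF abs_ge_self])
    have "\<bar>y - z\<bar> \<le> 2" using assms by linarith
    then show "\<bar>(y - z) * f (x j) ^ k\<bar> \<le> 2 * norm (x j) ^ k"
      unfolding abs_mult by (intro mult_mono dual_ball_power_le[OF f]) auto
  qed
  then show "(\<Sum>i<n. (s(j := y)) i * f (x i) ^ k) \<le> rad_power_sup k n x (s(j := z)) + 2 * norm (x j) ^ k"
    using rad_power_sup_upper[OF f, where n = n and s = "s(j := z)" and x = x and k = k] unfolding e by (simp add: algebra_simps)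
qed

text \<open>On arguments of modulus at most |x_j| the map t^k has Lipschitz constant k |x_j|^(k-1).
  Moving |x_j|^(k-1) into the vector gives \<open>y j\<close> with norm |x_j|^k; the sum is then
  linear in f and bounded by the norm of a sign sum of vectors in V.\<close>

lemma ravg_rad_power_sup_le:
  fixes x :: "nat \<Rightarrow> 'a::real_normed_vector"
  assumes V: "subspace V" and \<tau>: "rad_type_ineq V r \<tau>" and r: "1 \<le> r" and k: "1 \<le> k"
    and x: "\<And>j. j < n \<Longrightarrow> x j \<in> V"
  shows "ravg n (rad_power_sup k n x) \<le> real k * \<tau> * (\<Sum>j<n. (norm (x j) ^ k) powr r) powr (1 / r)"
proof -
  define y where "y j = norm (x j) ^ (k - 1) *\<^sub>R x j" for j
  have ny: "norm (y j) = norm (x j) ^ k" for j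
    using k power_minus_mult[of k "norm (x j)"] by (simp add: y_def)
  let ?g = "\<lambda>s. norm (\<Sum>j<n. s j *\<^sub>R y j)"
  let ?S = "(\<Sum>j<n. (norm (x j) ^ k) powr r) powr (1 / r)"
  have ne: "dual_ball \<noteq> ({} :: ('a \<Rightarrow> real) set)" using zero_in_dual_ball by blast
  have "ravg n (rad_power_sup k n x) = ravg n (\<lambda>s. SUP f\<in>dual_ball. 0 + (\<Sum>j<n. s j * f (x j) ^ k))"
    by (simp add: rad_power_sup_def[abs_def])
  also have "\<dots> \<le> ravg n (\<lambda>s. SUP f\<in>dual_ball. 0 + (\<Sum>j<n. s j * (real k * norm (x j) ^ (k - 1) * f (x j))))"
  \<comment> \<open>A has to dominate the powers as well as their linearisations, hence its factor
    k; the offset is 0 at the start.\<close>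
  proof (rule ravg_contraction[where A = "\<lambda>j. real k * norm (x j) ^ k" and H = 0, OF ne])
    fix j and f g :: "'a \<Rightarrow> real" assume f: "f \<in> dual_ball" and g: "g \<in> dual_ball"
    show "\<bar>f (x j) ^ k - g (x j) ^ k\<bar>
        \<le> \<bar>real k * norm (x j) ^ (k - 1) * f (x j) - real k * norm (x j) ^ (k - 1) * g (x j)\<bar>"
      using abs_power_diff_le[OF dual_ball_le[OF f] dual_ball_le[OF g], of "x j" k]
      unfolding right_diff_distrib[symmetric] by (simp add: abs_mult)
  next
    fix j and f :: "'a \<Rightarrow> real" assume f: "f \<in> dual_ball"
    have "norm (x j) ^ (k - 1) * \<bar>f (x j)\<bar> \<le> norm (x j) ^ (k - 1) * norm (x j)"
      by (intro mult_left_mono dual_ball_le[OF f]) simp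
    also have "\<dots> = norm (x j) ^ k" using k power_minus_mult[of k "norm (x j)"] by simp
    finally show "\<bar>real k * norm (x j) ^ (k - 1) * f (x j)\<bar> \<le> real k * norm (x j) ^ k"
      by (simp add: abs_mult mult.assoc mult_left_mono)
    have "1 * norm (x j) ^ k \<le> real k * norm (x j) ^ k" using k by (intro mult_right_mono) auto
    then show "\<bar>f (x j) ^ k\<bar> \<le> real k * norm (x j) ^ k"
      using dual_ball_power_le[OF f, of "x j" k] by linarith
  qed simp
  also have "\<dots> \<le> ravg n (\<lambda>s. real k * ?g s)"
  proof (rule ravg_mono, rule cSUP_least[OF ne])
    fix s and f :: "'a \<Rightarrow> real" assume f: "f \<in> dual_ball"
    have "0 + (\<Sum>j<n. s j * (real k * norm (x j) ^ (k - 1) * f (x j))) = real k * f (\<Sum>j<n. s j *\<^sub>R y j)"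
      using bounded_linear.linear[OF dual_ball_linear[OF f]]
      by (simp add: y_def linear_sum linear_cmul sum_distrib_left mult.left_commute mult.assoc)
    also have "\<dots> \<le> real k * ?g s"
      using dual_ball_le[OF f, of "\<Sum>j<n. s j *\<^sub>R y j"] by (intro mult_left_mono) auto
    finally show "0 + (\<Sum>j<n. s j * (real k * norm (x j) ^ (k - 1) * f (x j))) \<le> real k * ?g s" .
  qed
  also have "\<dots> = real k * ravg n ?g" by (rule ravg_cmult)
  also have "\<dots> \<le> real k * (\<tau> * ?S)"
  proof (rule mult_left_mono)
    have "y j \<in> V" if "j < n" for j using x[OF that] V by (simp add: y_def subspace_scale)
    then have t: "ravg n (\<lambda>s. ?g s powr r) powr (1 / r) \<le> \<tau> * (\<Sum>j<n. norm (y j) powr r) powr (1 / r)"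
      using \<tau> unfolding rad_type_ineq_def ravg_norm_powr_eq by (elim conjE allE[of _ n] allE[of _ y]) simp
    have g: "0 \<le> ravg n ?g" by (rule ravg_nonneg) simp
    \<comment> \<open>The contraction left a first moment, whereas the type inequality speaks of the
      r-th one.\<close>
    have "ravg n ?g powr r \<le> ravg n (\<lambda>s. ?g s powr r)" using r by (intro ravg_power_mean) auto
    then have "(ravg n ?g powr r) powr (1 / r) \<le> ravg n (\<lambda>s. ?g s powr r) powr (1 / r)"
      using r by (intro powr_mono2) auto
    then have "ravg n ?g \<le> ravg n (\<lambda>s. ?g s powr r) powr (1 / r)"
      using g r by (simp add: powr_powr)
    with t show "ravg n ?g \<le> \<tau> * ?S" unfolding ny by linarith
  qed simp
  finally show ?thesis by (simp add: mult.assoc)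
qed

lemma ravg_rad_power_sup_powr_le:
  fixes x :: "nat \<Rightarrow> 'a::real_normed_vector"
  assumes V: "subspace V" and \<tau>: "rad_type_ineq V r \<tau>" "1 \<le> \<tau>" and r: "1 \<le> r" "r \<le> 2" "r \<le> q"
    and k: "1 \<le> k" and x: "\<And>j. j < n \<Longrightarrow> x j \<in> V"
  shows "ravg n (\<lambda>s. rad_power_sup k n x s powr q) \<le>
    2 powr q * (real k powr q + q powr q * exp 1) * \<tau> powr q *
      (real n powr (q / r - 1) * (\<Sum>j<n. (norm (x j) ^ k) powr q))"
proof -
  define S where "S = (\<Sum>j<n. (norm (x j) ^ k) powr r) powr (1 / r)"
  have q: "0 < q" using r by simp
  have S0: "0 \<le> S" by (simp add: S_def)
  have "S powr q = (\<Sum>j<n. (norm (x j) ^ k) powr r) powr (q / r)" by (simp add: S_def powr_powr)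
  also have "\<dots> \<le> real n powr (q / r - 1) * (\<Sum>j<n. ((norm (x j) ^ k) powr r) powr (q / r))"
    using r by (intro powr_sum_le) auto
  also have "\<dots> = real n powr (q / r - 1) * (\<Sum>j<n. (norm (x j) ^ k) powr q)"
    using r by (simp add: powr_powr)
  finally have Sq: "S powr q \<le> \<dots>" .
  have "ravg n (\<lambda>s. rad_power_sup k n x s powr q)
    \<le> 2 powr q * (real k powr q + q powr q * exp 1) * \<tau> powr q * S powr q"
  proof (cases "S = 0")
    \<comment> \<open>Concentration needs a positive scale. If S = 0, all vectors vanish, and so
      does the supremum because \<open>1 \<le> k\<close>.\<close>
    case True
    then have "(\<Sum>j<n. (norm (x j) ^ k) powr r) = 0" by (simp add: S_def)
    then have "\<forall>j<n. (norm (x j) ^ k) powr r = 0"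
      by (subst (asm) sum_nonneg_eq_0_iff) auto
    then have x0: "x j = 0" if "j < n" for j using that k by auto
    have "rad_power_sup k n x s = 0" for s
    proof -
      have "(\<Sum>j<n. s j * f (x j) ^ k) = 0" if "f \<in> dual_ball" for f
        using x0 k linear_0[OF bounded_linear.linear[OF dual_ball_linear[OF that]]]
        by (intro sum.neutral) auto
      then have "rad_power_sup k n x s = (SUP f\<in>(dual_ball::('a \<Rightarrow> real) set). 0)"
        unfolding rad_power_sup_def by (intro SUP_cong) auto
      also have "\<dots> = 0" using zero_in_dual_ball by (intro cSUP_const) blast
      finally show ?thesis .
    qed
    then show ?thesis using True by simp
  next
    case False
    then have S: "0 < S" using S0 by simp
    have "ravg n (\<lambda>s. rad_power_sup k n x s powr q)
      \<le> 2 powr q * (ravg n (rad_power_sup k n x) powr q + q powr q * exp 1 * S powr q)"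
    proof (rule ravg_powr_bounded_differences[where c = "\<lambda>j. norm (x j) ^ k", OF _ _ S _ q])
      show "(\<Sum>j<n. (norm (x j) ^ k)\<^sup>2) \<le> S\<^sup>2"
        unfolding S_def using r by (intro sum_squares_le_powr) auto
      show "0 \<le> rad_power_sup k n x s" for s by (rule rad_power_sup_nonneg[OF k])
      show "\<bar>rad_power_sup k n x (s(j := 1)) - rad_power_sup k n x (s(j := - 1))\<bar> \<le> 2 * norm (x j) ^ k"
        if "j < n" for j s
        using rad_power_sup_update_le[OF that, of 1 "-1" k x s]
          rad_power_sup_update_le[OF that, of "-1" 1 k x s] by simp
    qed
    also have "\<dots> \<le> 2 powr q * ((real k * \<tau> * S) powr q + q powr q * exp 1 * (\<tau> * S) powr q)"
    proof (intro mult_left_mono add_mono powr_mono2)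
      show "0 \<le> ravg n (rad_power_sup k n x)"
        by (intro ravg_nonneg rad_power_sup_nonneg k)
      show "ravg n (rad_power_sup k n x) \<le> real k * \<tau> * S"
        unfolding S_def by (rule ravg_rad_power_sup_le[OF V \<tau>(1) r(1) k x])
      show "S \<le> \<tau> * S" using \<tau>(2) S by simp
    qed (use q S in auto)
    also have "\<dots> = 2 powr q * (real k powr q + q powr q * exp 1) * \<tau> powr q * S powr q"
      using \<tau> S by (simp add: powr_mult algebra_simps)
    finally show ?thesis .
  qed
  also have "\<dots> \<le> 2 powr q * (real k powr q + q powr q * exp 1) * \<tau> powr q *
      (real n powr (q / r - 1) * (\<Sum>j<n. (norm (x j) ^ k) powr q))"
    using Sq by (intro mult_left_mono) auto
  finally show ?thesis .
qed

text \<open>The absolute value of a sign sum is at most the one-sided supremum at s or at -s. Both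
  have the same average, so the price is a factor 2.\<close>

lemma ravg_SUP_abs_power_le:
  fixes x :: "nat \<Rightarrow> 'a::real_normed_vector"
  assumes V: "subspace V" and \<tau>: "rad_type_ineq V r \<tau>" "1 \<le> \<tau>" and r: "1 \<le> r" "r \<le> 2" "r \<le> q"
    and k: "1 \<le> k" and x: "\<And>j. j < n \<Longrightarrow> x j \<in> V" and D: "D \<subseteq> dual_ball"
  shows "ravg n (\<lambda>s. SUP f\<in>D. ennreal (\<bar>\<Sum>j<n. s j * f (x j) ^ k\<bar> powr q)) \<le>
    ennreal (2 * (2 powr q * (real k powr q + q powr q * exp 1)) * \<tau> powr q *
      (real n powr (q / r - 1) * (\<Sum>j<n. (norm (x j) ^ k) powr q)))"
    (is "_ \<le> ennreal (2 * ?K * ?T * ?X)")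
proof -
  let ?Z = "rad_power_sup k n x"
  have q: "0 < q" using r by simp
  have "(SUP f\<in>D. ennreal (\<bar>\<Sum>j<n. s j * f (x j) ^ k\<bar> powr q))
      \<le> ennreal (?Z s powr q + ?Z (\<lambda>j. - s j) powr q)" for s
  proof (intro SUP_least ennreal_leI)
    fix f assume "f \<in> D"
    then have f: "f \<in> dual_ball" using D by blast
    let ?a = "\<Sum>j<n. s j * f (x j) ^ k"
    have "?a \<le> ?Z s" "- ?a \<le> ?Z (\<lambda>j. - s j)"
      using rad_power_sup_upper[OF f, where k = k and n = n and x = x and s = s]
        rad_power_sup_upper[OF f, where k = k and n = n and x = x and s = "\<lambda>j. - s j"]
      by (simp_all add: sum_negf)
    then have "\<bar>?a\<bar> \<le> ?Z s \<or> \<bar>?a\<bar> \<le> ?Z (\<lambda>j. - s j)" by linarith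
    then have "\<bar>?a\<bar> powr q \<le> ?Z s powr q \<or> \<bar>?a\<bar> powr q \<le> ?Z (\<lambda>j. - s j) powr q"
      using q by (auto intro: powr_mono2)
    then show "\<bar>?a\<bar> powr q \<le> ?Z s powr q + ?Z (\<lambda>j. - s j) powr q"
      using powr_ge_zero[of "?Z s" q] powr_ge_zero[of "?Z (\<lambda>j. - s j)" q] by linarith
  qed
  then have "ravg n (\<lambda>s. SUP f\<in>D. ennreal (\<bar>\<Sum>j<n. s j * f (x j) ^ k\<bar> powr q))
      \<le> ravg n (\<lambda>s. ennreal (?Z s powr q + ?Z (\<lambda>j. - s j) powr q))" by (rule ravg_mono_ennreal)
  also have "\<dots> = ennreal (ravg n (\<lambda>s. ?Z s powr q + ?Z (\<lambda>j. - s j) powr q))"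
    by (rule ravg_ennreal) simp
  also have "ravg n (\<lambda>s. ?Z s powr q + ?Z (\<lambda>j. - s j) powr q) = 2 * ravg n (\<lambda>s. ?Z s powr q)"
    using ravg_uminus[of n "\<lambda>s. ?Z s powr q"] by (simp add: ravg_add)
  also have "ennreal (2 * ravg n (\<lambda>s. ?Z s powr q)) \<le> ennreal (2 * (?K * ?T * ?X))"
    by (intro ennreal_leI mult_left_mono ravg_rad_power_sup_powr_le[OF V \<tau> r k x]) auto
  finally show ?thesis by (simp only: mult.assoc)
qed


section \<open>Symmetrization\<close>

text \<open>The q-th power of the supremum norm of a sequence, with one entry for each functional of
  a countable family. Values in \<open>ennreal\<close> dispense with boundedness conditions, and the
  countable index keeps it measurable whenever the entries are.\<close>

definition sup_pow :: "real \<Rightarrow> (nat \<Rightarrow> real) \<Rightarrow> ennreal" where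
  "sup_pow q v = (SUP i. ennreal (\<bar>v i\<bar> powr q))"

lemma sup_pow_upper: "ennreal (\<bar>v i\<bar> powr q) \<le> sup_pow q v"
  unfolding sup_pow_def by (rule SUP_upper) simp

lemma measurable_sup_pow [measurable]:
  assumes [measurable]: "\<And>i. (\<lambda>x. v x i) \<in> borel_measurable N"
  shows "(\<lambda>x. sup_pow q (v x)) \<in> borel_measurable N"
  unfolding sup_pow_def by measurable

lemma sup_pow_cmult:
  assumes "0 \<le> c"
  shows "sup_pow q (\<lambda>i. c * v i) = ennreal (c powr q) * sup_pow q v"
  unfolding sup_pow_def using assms
  by (simp add: SUP_mult_left_ennreal abs_mult powr_mult ennreal_mult)

lemma sup_pow_mean:
  assumes "1 \<le> q"
  shows "sup_pow q (\<lambda>i. (a i + b i) / 2) \<le> (sup_pow q a + sup_pow q b) / 2"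
  unfolding sup_pow_def[of q "\<lambda>i. (a i + b i) / 2"]
proof (rule SUP_least)
  fix i
  have "ennreal (\<bar>(a i + b i) / 2\<bar> powr q) \<le> ennreal ((\<bar>a i\<bar> powr q + \<bar>b i\<bar> powr q) / 2)"
    by (intro ennreal_leI abs_mean_powr_le assms)
  also have "\<dots> = (ennreal (\<bar>a i\<bar> powr q) + ennreal (\<bar>b i\<bar> powr q)) / 2"
    by (rule ennreal_mean) auto
  also have "\<dots> \<le> (sup_pow q a + sup_pow q b) / 2"
    by (intro divide_right_mono_ennreal add_mono sup_pow_upper)
  finally show "ennreal (\<bar>(a i + b i) / 2\<bar> powr q) \<le> (sup_pow q a + sup_pow q b) / 2" .
qed

text \<open>An infinite right side is trivial; a finite one supplies the integrability of the powers
  that Jensen's inequality asks for.\<close>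

lemma (in prob_space) abs_integral_powr_le:
  fixes Y :: "'a \<Rightarrow> real"
  assumes q: "1 \<le> q" and Y: "integrable M Y"
  shows "ennreal (\<bar>\<integral>x. Y x \<partial>M\<bar> powr q) \<le> (\<integral>\<^sup>+x. ennreal (\<bar>Y x\<bar> powr q) \<partial>M)"
proof (cases "(\<integral>\<^sup>+x. ennreal (\<bar>Y x\<bar> powr q) \<partial>M) < \<infinity>")
  case True
  have [measurable]: "Y \<in> borel_measurable M" using Y by simp
  have i: "integrable M (\<lambda>x. \<bar>Y x\<bar> powr q)"
    using True by (intro integrableI_nonneg) auto
  have "\<bar>\<integral>x. Y x \<partial>M\<bar> powr q \<le> (\<integral>x. \<bar>Y x\<bar> powr q \<partial>M)"
    using jensens_inequality[OF Y _ _ i convex_on_abs_powr[OF q]] by simp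
  also have "ennreal \<dots> = (\<integral>\<^sup>+x. ennreal (\<bar>Y x\<bar> powr q) \<partial>M)"
    using i by (intro nn_integral_eq_integral[symmetric]) auto
  finally show ?thesis by (simp add: ennreal_leI)
next
  case False
  then have "(\<integral>\<^sup>+x. ennreal (\<bar>Y x\<bar> powr q) \<partial>M) = \<top>" by (simp add: not_less top_unique)
  then show ?thesis by simp
qed

text \<open>Convexity applied to v + (g - E g) = ((v + 2 g) + (v - 2 E g)) / 2, then Jensen for the second part.\<close>

lemma (in prob_space) symmetrization_step:
  fixes g :: "nat \<Rightarrow> 'a \<Rightarrow> real" and v :: "nat \<Rightarrow> real"
  assumes q: "1 \<le> q" and g: "\<And>i. integrable M (g i)"
  shows "(\<integral>\<^sup>+y. sup_pow q (\<lambda>i. v i + (g i y - (\<integral>z. g i z \<partial>M))) \<partial>M)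
    \<le> ((\<integral>\<^sup>+y. sup_pow q (\<lambda>i. v i + 2 * g i y) \<partial>M) + (\<integral>\<^sup>+y. sup_pow q (\<lambda>i. v i - 2 * g i y) \<partial>M)) / 2"
proof -
  have [measurable]: "g i \<in> borel_measurable M" for i using g[of i] by simp
  define e where "e i = (\<integral>z. g i z \<partial>M)" for i
  have J: "sup_pow q (\<lambda>i. v i - 2 * e i) \<le> (\<integral>\<^sup>+y. sup_pow q (\<lambda>i. v i - 2 * g i y) \<partial>M)"
    unfolding sup_pow_def[of q "\<lambda>i. v i - 2 * e i"]
  proof (rule SUP_least)
    fix i
    have "v i - 2 * e i = (\<integral>y. v i - 2 * g i y \<partial>M)"
      using g[of i] by (simp add: e_def prob_space)
    then have "ennreal (\<bar>v i - 2 * e i\<bar> powr q) \<le> (\<integral>\<^sup>+y. ennreal (\<bar>v i - 2 * g i y\<bar> powr q) \<partial>M)"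
      using abs_integral_powr_le[OF q, of "\<lambda>y. v i - 2 * g i y"] g[of i] by (simp only:) simp
    also have "\<dots> \<le> (\<integral>\<^sup>+y. sup_pow q (\<lambda>i. v i - 2 * g i y) \<partial>M)"
      by (intro nn_integral_mono sup_pow_upper[where v = "\<lambda>i. v i - 2 * g i _"])
    finally show "ennreal (\<bar>v i - 2 * e i\<bar> powr q) \<le> (\<integral>\<^sup>+y. sup_pow q (\<lambda>i. v i - 2 * g i y) \<partial>M)" .
  qed
  have "sup_pow q (\<lambda>i. v i + (g i y - e i)) \<le> (sup_pow q (\<lambda>i. v i + 2 * g i y) + sup_pow q (\<lambda>i. v i - 2 * e i)) / 2" for y
    using sup_pow_mean[OF q, of "\<lambda>i. v i + 2 * g i y" "\<lambda>i. v i - 2 * e i"]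
    by (simp add: diff_divide_distrib add_divide_distrib add_diff_eq)
  then have "(\<integral>\<^sup>+y. sup_pow q (\<lambda>i. v i + (g i y - e i)) \<partial>M)
      \<le> (\<integral>\<^sup>+y. (sup_pow q (\<lambda>i. v i + 2 * g i y) + sup_pow q (\<lambda>i. v i - 2 * e i)) / 2 \<partial>M)"
    by (intro nn_integral_mono)
  also have "\<dots> = ((\<integral>\<^sup>+y. sup_pow q (\<lambda>i. v i + 2 * g i y) \<partial>M) + sup_pow q (\<lambda>i. v i - 2 * e i)) / 2"
    by (simp add: nn_integral_divide nn_integral_add emeasure_space_1)
  also have "\<dots> \<le> ((\<integral>\<^sup>+y. sup_pow q (\<lambda>i. v i + 2 * g i y) \<partial>M) + (\<integral>\<^sup>+y. sup_pow q (\<lambda>i. v i - 2 * g i y) \<partial>M)) / 2"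
    by (intro divide_right_mono_ennreal add_left_mono J)
  finally show ?thesis by (simp add: e_def)
qed

lemma measurable_ravg [measurable]:
  fixes h :: "'b \<Rightarrow> (nat \<Rightarrow> real) \<Rightarrow> ennreal"
  assumes "\<And>s. (\<lambda>x. h x s) \<in> borel_measurable N"
  shows "(\<lambda>x. ravg n (h x)) \<in> borel_measurable N"
  using assms
proof (induction n arbitrary: h)
  case (Suc n)
  have [measurable]: "(\<lambda>x. ravg n (\<lambda>s. h x (s(n := y)))) \<in> borel_measurable N" for y
    by (intro Suc)
  show ?case unfolding ravg.simps by measurable
qed simp

text \<open>The newest coordinate is symmetrised with the others held fixed; then the order of
  integration is reversed. With the new sample fixed, its signed term joins v and the induction
  hypothesis treats the rest, which is why v is arbitrary. \<open>Suc j\<close> matches samples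
  numbered from 1 with signs numbered from 0.\<close>

lemma (in prob_space) symmetrization:
  fixes g :: "nat \<Rightarrow> 'a \<Rightarrow> real" and v :: "nat \<Rightarrow> real"
  assumes q: "1 \<le> q" and g: "\<And>i. integrable M (g i)"
  shows "(\<integral>\<^sup>+w. sup_pow q (\<lambda>i. v i + (\<Sum>j<n. g i (w (Suc j)) - (\<integral>z. g i z \<partial>M))) \<partial>(\<Pi>\<^sub>M j\<in>{1..n}. M))
    \<le> (\<integral>\<^sup>+w. ravg n (\<lambda>s. sup_pow q (\<lambda>i. v i + 2 * (\<Sum>j<n. s j * g i (w (Suc j))))) \<partial>(\<Pi>\<^sub>M j\<in>{1..n}. M))"
proof (induction n arbitrary: v)
  case 0
  show ?case by simp
next
  case (Suc n)
  interpret product_sigma_finite "\<lambda>_::nat. M" by unfold_locales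
  have gm [measurable]: "g i \<in> borel_measurable M" for i using g[of i] by simp
  define e where "e i = (\<integral>z. g i z \<partial>M)" for i
  let ?P = "\<lambda>n. \<Pi>\<^sub>M j\<in>{1..n}. M"
  let ?Q = "\<Pi>\<^sub>M j\<in>insert (Suc n) {1..n}. M"
  have I: "{1..Suc n} = insert (Suc n) {1..n}" by auto
  have f: "finite {1..n}" "Suc n \<notin> {1..n}" by auto
  have gP [measurable]: "(\<lambda>w. g i (w (Suc j))) \<in> borel_measurable (?P n)" if "j \<in> {..<n}" for i j
    using that by (intro measurable_compose[OF _ gm] measurable_component_singleton) auto
  have gQ [measurable]: "(\<lambda>w. g i (w (Suc j))) \<in> borel_measurable ?Q" if "j \<in> {..<Suc n}" for i j
    using that by (intro measurable_compose[OF _ gm] measurable_component_singleton) auto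
  have gQ' [measurable]: "(\<lambda>w. g i (w (Suc j))) \<in> borel_measurable ?Q" if "j \<in> {..<n}" for i j
    using that by (intro gQ) auto
  have upd: "(\<Sum>j<n. f j ((x(Suc n := y)) (Suc j))) = (\<Sum>j<n. f j (x (Suc j)))" for f :: "nat \<Rightarrow> 'a \<Rightarrow> real" and x y
    by (intro sum.cong) auto
  have upd': "(\<Sum>j<n. (s(n := \<sigma>)) j * c j) = (\<Sum>j<n. s j * c j)" for s \<sigma> and c :: "nat \<Rightarrow> real"
    by (intro sum.cong) auto
  \<comment> \<open>The intermediate stage: the last coordinate already carries the fixed sign
    \<sigma>, the others are still centred.\<close>
  define T where "T \<sigma> = (\<integral>\<^sup>+x. \<integral>\<^sup>+y. sup_pow q (\<lambda>i. (v i + (\<Sum>j<n. g i (x (Suc j)) - e i)) + \<sigma> * (2 * g i y)) \<partial>M \<partial>(?P n))" for \<sigma>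
  have mT [measurable]: "(\<lambda>w. sup_pow q (\<lambda>i. (v i + (\<Sum>j<n. g i (w (Suc j)) - e i)) + \<sigma> * (2 * g i (w (Suc n))))) \<in> borel_measurable ?Q" for \<sigma>
    by measurable
  have mR [measurable]: "(\<lambda>w. ravg n (\<lambda>s. sup_pow q (\<lambda>i. v i + 2 * (\<Sum>j<Suc n. (s(n := \<sigma>)) j * g i (w (Suc j)))))) \<in> borel_measurable ?Q" for \<sigma>
    by measurable
  have T: "T \<sigma> \<le> (\<integral>\<^sup>+w. ravg n (\<lambda>s. sup_pow q (\<lambda>i. v i + 2 * (\<Sum>j<Suc n. (s(n := \<sigma>)) j * g i (w (Suc j))))) \<partial>?Q)" for \<sigma>
  proof -
    have "T \<sigma> = (\<integral>\<^sup>+w. sup_pow q (\<lambda>i. (v i + (\<Sum>j<n. g i (w (Suc j)) - e i)) + \<sigma> * (2 * g i (w (Suc n)))) \<partial>?Q)"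
      unfolding T_def by (subst product_nn_integral_insert[OF f mT]) (simp add: upd[of "\<lambda>j z. g _ z - e _"])
    also have "\<dots> = (\<integral>\<^sup>+y. \<integral>\<^sup>+x. sup_pow q (\<lambda>i. (v i + \<sigma> * (2 * g i y)) + (\<Sum>j<n. g i (x (Suc j)) - e i)) \<partial>(?P n) \<partial>M)"
      by (subst product_nn_integral_insert_rev[OF f mT]) (simp add: upd[of "\<lambda>j z. g _ z - e _"] add_ac)
    also have "\<dots> \<le> (\<integral>\<^sup>+y. \<integral>\<^sup>+x. ravg n (\<lambda>s. sup_pow q (\<lambda>i. (v i + \<sigma> * (2 * g i y)) + 2 * (\<Sum>j<n. s j * g i (x (Suc j))))) \<partial>(?P n) \<partial>M)"
      unfolding e_def by (intro nn_integral_mono Suc.IH)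
    also have "\<dots> = (\<integral>\<^sup>+w. ravg n (\<lambda>s. sup_pow q (\<lambda>i. v i + 2 * (\<Sum>j<Suc n. (s(n := \<sigma>)) j * g i (w (Suc j))))) \<partial>?Q)"
      unfolding product_nn_integral_insert_rev[OF f mR]
      by (simp add: upd[of "\<lambda>j z. _ j * g _ z"] upd' algebra_simps)
    finally show ?thesis .
  qed
  have "(\<integral>\<^sup>+w. sup_pow q (\<lambda>i. v i + (\<Sum>j<Suc n. g i (w (Suc j)) - e i)) \<partial>(?P (Suc n)))
      = (\<integral>\<^sup>+x. \<integral>\<^sup>+y. sup_pow q (\<lambda>i. (v i + (\<Sum>j<n. g i (x (Suc j)) - e i)) + (g i y - e i)) \<partial>M \<partial>(?P n))"
    unfolding I by (subst product_nn_integral_insert[OF f])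
      (simp_all add: upd[of "\<lambda>j z. g _ z - e _"] add.assoc)
  also have "\<dots> \<le> (\<integral>\<^sup>+x. ((\<integral>\<^sup>+y. sup_pow q (\<lambda>i. (v i + (\<Sum>j<n. g i (x (Suc j)) - e i)) + 1 * (2 * g i y)) \<partial>M)
      + (\<integral>\<^sup>+y. sup_pow q (\<lambda>i. (v i + (\<Sum>j<n. g i (x (Suc j)) - e i)) + (-1) * (2 * g i y)) \<partial>M)) / 2 \<partial>(?P n))"
    using symmetrization_step[OF q g] unfolding e_def by (intro nn_integral_mono) simp
  also have "\<dots> = (T 1 + T (-1)) / 2"
    unfolding T_def by (subst nn_integral_divide, measurable) (subst nn_integral_add, measurable)
  also have "\<dots> \<le> ((\<integral>\<^sup>+w. ravg n (\<lambda>s. sup_pow q (\<lambda>i. v i + 2 * (\<Sum>j<Suc n. (s(n := 1)) j * g i (w (Suc j))))) \<partial>?Q)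
      + (\<integral>\<^sup>+w. ravg n (\<lambda>s. sup_pow q (\<lambda>i. v i + 2 * (\<Sum>j<Suc n. (s(n := -1)) j * g i (w (Suc j))))) \<partial>?Q)) / 2"
    by (intro divide_right_mono_ennreal add_mono T)
  also have "\<dots> = (\<integral>\<^sup>+w. (ravg n (\<lambda>s. sup_pow q (\<lambda>i. v i + 2 * (\<Sum>j<Suc n. (s(n := 1)) j * g i (w (Suc j)))))
      + ravg n (\<lambda>s. sup_pow q (\<lambda>i. v i + 2 * (\<Sum>j<Suc n. (s(n := -1)) j * g i (w (Suc j)))))) / 2 \<partial>?Q)"
    by (subst nn_integral_divide, measurable) (subst nn_integral_add[OF mR mR], rule refl)
  also have "\<dots> = (\<integral>\<^sup>+w. ravg (Suc n) (\<lambda>s. sup_pow q (\<lambda>i. v i + 2 * (\<Sum>j<Suc n. s j * g i (w (Suc j))))) \<partial>(?P (Suc n)))"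
    unfolding I ravg.simps ..
  finally show ?case unfolding e_def .
qed


section \<open>From the product space to the sampling error\<close>

lemma ravg_cmult_ennreal:
  fixes g :: "(nat \<Rightarrow> real) \<Rightarrow> ennreal"
  shows "ravg n (\<lambda>s. c * g s) = c * ravg n g"
  by (induction n arbitrary: g) (simp_all add: distrib_left[symmetric] ennreal_times_divide)

lemma le_one_plus_powr:
  fixes t q :: real
  assumes "0 \<le> t" "1 \<le> q"
  shows "t \<le> 1 + t powr q"
proof (cases "t \<le> 1")
  case True
  then show ?thesis by (simp add: add_increasing2)
next
  case False
  then have "t powr 1 \<le> t powr q" using assms by (intro powr_mono) auto
  then show ?thesis using assms by simp
qed

text \<open>\<open>1 \<le> k\<close> matters at x = 0, since \<open>0 ^ 0 = 1\<close> whereas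
  \<open>0 powr 0 = 0\<close>.\<close>

lemma norm_power_powr: "1 \<le> k \<Longrightarrow> (norm x ^ k) powr q = norm x powr (real k * q)"
  by (cases "x = 0") (simp_all add: powr_powr flip: powr_realpow)

lemma borel_measurable_dual_ball: "f \<in> dual_ball \<Longrightarrow> f \<in> borel_measurable borel"
  by (intro borel_measurable_continuous_onI linear_continuous_on dual_ball_linear)

lemma borel_measurable_norm_powr:
  "(\<lambda>x::'a::real_normed_vector. norm x powr p) \<in> borel_measurable borel"
proof -
  have [measurable]: "(norm :: 'a \<Rightarrow> real) \<in> borel_measurable borel"
    by (intro borel_measurable_continuous_onI continuous_on_norm_id)
  show ?thesis by measurable
qed

text \<open>Dominated convergence: approximating a functional pointwise on V also approximates the
  moment, so the countable family serves both parts of the sampling error.\<close>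

lemma (in prob_space) tendsto_moment:
  fixes Y :: "'a \<Rightarrow> 'b::real_normed_vector"
  assumes Y: "Y \<in> borel_measurable M" "AE w in M. Y w \<in> V" "integrable M (\<lambda>w. norm (Y w) ^ k)"
    and F: "\<And>n. F n \<in> dual_ball" "f \<in> dual_ball" "\<And>x. x \<in> V \<Longrightarrow> (\<lambda>n. F n x) \<longlonglongrightarrow> f x"
  shows "(\<lambda>n. \<integral>w. F n (Y w) ^ k \<partial>M) \<longlonglongrightarrow> (\<integral>w. f (Y w) ^ k \<partial>M)"
proof (rule integral_dominated_convergence[OF _ _ Y(3)])
  have m: "(\<lambda>w. h (Y w) ^ k) \<in> borel_measurable M" if "h \<in> dual_ball" for h
    by (intro borel_measurable_power measurable_compose[OF Y(1) borel_measurable_dual_ball[OF that]])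
  show "(\<lambda>w. f (Y w) ^ k) \<in> borel_measurable M" "(\<lambda>w. F n (Y w) ^ k) \<in> borel_measurable M" for n
    using m F by auto
  show "AE w in M. (\<lambda>n. F n (Y w) ^ k) \<longlonglongrightarrow> f (Y w) ^ k"
    using Y(2) by eventually_elim (intro tendsto_power F(3))
  show "AE w in M. norm (F n (Y w) ^ k) \<le> norm (Y w) ^ k" for n
    using dual_ball_power_le[OF F(1)[of n]] by simp
qed

lemma (in prob_space) integrable_norm_power:
  fixes Y :: "'a \<Rightarrow> 'b::real_normed_vector"
  assumes "Y \<in> borel_measurable M" "integrable M (\<lambda>w. norm (Y w) powr (real k * q))" "1 \<le> q" "1 \<le> k"
  shows "integrable M (\<lambda>w. norm (Y w) ^ k)"
proof (rule Bochner_Integration.integrable_bound)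
  show "integrable M (\<lambda>w. 1 + norm (Y w) powr (real k * q))" using assms by simp
  have "(\<lambda>w. norm (Y w) powr 1) \<in> borel_measurable M"
    by (rule measurable_compose[OF assms(1) borel_measurable_norm_powr])
  then show "(\<lambda>w. norm (Y w) ^ k) \<in> borel_measurable M" by (simp add: borel_measurable_power)
  show "AE w in M. norm (norm (Y w) ^ k) \<le> norm (1 + norm (Y w) powr (real k * q))"
    using le_one_plus_powr[OF _ assms(3), of "norm (Y _) ^ k"] unfolding norm_power_powr[OF assms(4)]
    by (intro AE_I2) (simp add: add_nonneg_nonneg)
qed

text \<open>By independence the first m samples have the m-fold product of the common law N as joint
  law, so the estimate takes place on that product space. The powers of m are m^(q/r-1) from the
  sign bound, m from adding equal moments and m^(-q) from the normalisation, together
  m^(q/r-q).\<close>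

lemma (in prob_space) sup_pow_sampling_error_le:
  fixes Y :: "'a \<Rightarrow> 'b::real_normed_vector" and F :: "nat \<Rightarrow> 'b \<Rightarrow> real"
  assumes V: "subspace V" "closed V" and \<tau>: "rad_type_ineq V r \<tau>" "1 \<le> \<tau>"
    and r: "1 \<le> r" "r \<le> 2" "r \<le> q" and k: "1 \<le> k" and m: "1 \<le> m"
    and Y: "Y \<in> borel_measurable M" "AE w in M. Y w \<in> V" "integrable M (\<lambda>w. norm (Y w) powr (real k * q))"
    and Ys: "indep_vars (\<lambda>_. borel) Ys {1::nat..}" "\<And>j. 1 \<le> j \<Longrightarrow> distr M borel (Ys j) = distr M borel Y"
    and F: "\<And>i. F i \<in> dual_ball"
  shows "(\<integral>\<^sup>+w. sup_pow q (\<lambda>i. (\<integral>v. F i (Y v) ^ k \<partial>M) - (\<Sum>j=1..m. F i (Ys j w) ^ k) / real m) \<partial>M)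
    \<le> ennreal (2 powr q * (2 * (2 powr q * (real k powr q + q powr q * exp 1))) * \<tau> powr q *
        (\<integral>w. norm (Y w) powr (real k * q) \<partial>M) * real m powr (q / r - q))"
proof -
  define N where "N = distr M borel Y"
  interpret N: prob_space N unfolding N_def by (rule prob_space_distr[OF Y(1)])
  define g where "g i x = F i x ^ k" for i x
  define e where "e i = (\<integral>x. g i x \<partial>N)" for i
  define K where "K = 2 * (2 powr q * (real k powr q + q powr q * exp 1))"
  define B where "B = (\<integral>w. norm (Y w) powr (real k * q) \<partial>M)"
  let ?P = "\<Pi>\<^sub>M j\<in>{1..m}. N"
  let ?h = "\<lambda>w. sup_pow q (\<lambda>i. 0 + (\<Sum>j<m. g i (w (Suc j)) - e i))"
  let ?Y = "\<lambda>w. \<lambda>j\<in>{1..m}. Ys j w"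
  have q: "1 \<le> q" using r by simp
  have gb [measurable]: "g i \<in> borel_measurable borel" for i
    unfolding g_def by (intro borel_measurable_power borel_measurable_dual_ball F)
  have gm [measurable]: "g i \<in> borel_measurable N" for i
    using gb unfolding N_def by simp
  have Ym: "Ys j \<in> borel_measurable M" if "1 \<le> j" for j
    using Ys(1) that unfolding indep_vars_def by auto
  have gi: "integrable N (g i)" for i
  proof (unfold N_def, subst integrable_distr_eq[OF Y(1) gb], rule Bochner_Integration.integrable_bound)
    show "integrable M (\<lambda>w. norm (Y w) ^ k)" by (rule integrable_norm_power[OF Y(1,3) q k])
    show "(\<lambda>w. g i (Y w)) \<in> borel_measurable M" by (rule measurable_compose[OF Y(1) gb])
    show "AE w in M. norm (g i (Y w)) \<le> norm (norm (Y w) ^ k)"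
      using dual_ball_power_le[OF F[of i]] by (simp add: g_def)
  qed
  have e: "e i = (\<integral>v. F i (Y v) ^ k \<partial>M)" for i
    unfolding e_def N_def by (subst integral_distr[OF Y(1) gb]) (simp add: g_def)
  have gP [measurable]: "(\<lambda>w. g i (w (Suc j))) \<in> borel_measurable (\<Pi>\<^sub>M j\<in>{1..m}. borel)" if "j \<in> {..<m}" for i j
    using that by (intro measurable_compose[OF _ gb] measurable_component_singleton) auto
  have hm: "?h \<in> borel_measurable (\<Pi>\<^sub>M j\<in>{1..m}. borel)" by measurable
  have Ymm: "?Y \<in> measurable M (\<Pi>\<^sub>M j\<in>{1..m}. borel)"
    by (intro measurable_restrict Ym) auto
  have "indep_vars (\<lambda>_. borel) Ys {1..m}" by (rule indep_vars_subset[OF Ys(1)]) auto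
  then have "distr M (\<Pi>\<^sub>M j\<in>{1..m}. borel) ?Y = (\<Pi>\<^sub>M j\<in>{1..m}. distr M borel (Ys j))"
    using m Ym by (subst (asm) indep_vars_iff_distr_eq_PiM') auto
  also have "\<dots> = ?P" unfolding N_def by (intro PiM_cong) (auto simp: Ys(2))
  finally have dP: "distr M (\<Pi>\<^sub>M j\<in>{1..m}. borel) ?Y = ?P" .
  \<comment> \<open>Closedness makes V a Borel set, so that almost sure membership is a property of
    the law and passes to every sample.\<close>
  have "V \<in> sets borel" using V by (simp add: borel_closed)
  then have "AE x in N. x \<in> V" unfolding N_def using Y(2) by (subst AE_distr_iff[OF Y(1)]) auto
  then have "AE w in ?P. w j \<in> V" if "j \<in> {1..m}" for j
    by (rule AE_PiM_component[OF N.prob_space_axioms that])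
  then have PV: "AE w in ?P. \<forall>j\<in>{1..m}. w j \<in> V" by (intro AE_ball_countable') auto
  have nm: "(\<lambda>x. ennreal ((norm x ^ k) powr q)) \<in> borel_measurable N"
    unfolding norm_power_powr[OF k] N_def using borel_measurable_norm_powr by simp
  have "(\<integral>\<^sup>+x. ennreal ((norm x ^ k) powr q) \<partial>N) = (\<integral>\<^sup>+w. ennreal (norm (Y w) powr (real k * q)) \<partial>M)"
    unfolding norm_power_powr[OF k] N_def
    by (subst nn_integral_distr[OF Y(1)]) (use borel_measurable_norm_powr in simp_all)
  also have "\<dots> = ennreal B" unfolding B_def by (rule nn_integral_eq_integral[OF Y(3)]) simp
  finally have B: "(\<integral>\<^sup>+x. ennreal ((norm x ^ k) powr q) \<partial>N) = ennreal B" .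
  have comp: "(\<integral>\<^sup>+w. ennreal ((norm (w (Suc j)) ^ k) powr q) \<partial>?P) = ennreal B" if "j < m" for j
  proof -
    have j: "Suc j \<in> {1..m}" using that by auto
    have "(\<integral>\<^sup>+x. ennreal ((norm x ^ k) powr q) \<partial>(distr ?P N (\<lambda>w. w (Suc j))))
        = (\<integral>\<^sup>+w. ennreal ((norm (w (Suc j)) ^ k) powr q) \<partial>?P)"
      using nm by (intro nn_integral_distr measurable_component_singleton[OF j]) simp
    moreover have "distr ?P N (\<lambda>w. w (Suc j)) = N"
      using distr_PiM_component[OF N.prob_space_axioms j] by simp
    ultimately show ?thesis using B by simp
  qed
  have mm: "(\<lambda>w. ennreal ((norm (w (Suc j)) ^ k) powr q)) \<in> borel_measurable ?P" if "j < m" for j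
    using that by (intro measurable_compose[OF _ nm] measurable_component_singleton) auto
  have c0: "0 \<le> K * \<tau> powr q * real m powr (q / r - 1)" unfolding K_def by simp
  have pw: "ravg m (\<lambda>s. sup_pow q (\<lambda>i. 0 + 2 * (\<Sum>j<m. s j * g i (w (Suc j)))))
      \<le> ennreal (2 powr q) * (ennreal (K * \<tau> powr q * real m powr (q / r - 1)) * (\<Sum>j<m. ennreal ((norm (w (Suc j)) ^ k) powr q)))"
    if w: "\<forall>j\<in>{1..m}. w j \<in> V" for w
  proof -
    have "ravg m (\<lambda>s. sup_pow q (\<lambda>i. 0 + 2 * (\<Sum>j<m. s j * g i (w (Suc j)))))
        = ennreal (2 powr q) * ravg m (\<lambda>s. sup_pow q (\<lambda>i. \<Sum>j<m. s j * g i (w (Suc j))))"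
      unfolding add_0 using sup_pow_cmult[of 2 q] by (simp add: ravg_cmult_ennreal)
    also have "ravg m (\<lambda>s. sup_pow q (\<lambda>i. \<Sum>j<m. s j * g i (w (Suc j))))
        = ravg m (\<lambda>s. SUP f\<in>range F. ennreal (\<bar>\<Sum>j<m. s j * f (w (Suc j)) ^ k\<bar> powr q))"
      unfolding sup_pow_def g_def image_image ..
    also have "\<dots> \<le> ennreal (K * \<tau> powr q * (real m powr (q / r - 1) * (\<Sum>j<m. (norm (w (Suc j)) ^ k) powr q)))"
      unfolding K_def using w F by (intro ravg_SUP_abs_power_le[OF V(1) \<tau> r k]) auto
    also have "\<dots> = ennreal (K * \<tau> powr q * real m powr (q / r - 1)) * (\<Sum>j<m. ennreal ((norm (w (Suc j)) ^ k) powr q))"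
      using c0 by (simp add: ennreal_mult[symmetric] sum_nonneg mult.assoc)
    finally show ?thesis by (simp add: mult_left_mono)
  qed
  have "(\<integral>\<^sup>+w. ?h w \<partial>?P) \<le> (\<integral>\<^sup>+w. ravg m (\<lambda>s. sup_pow q (\<lambda>i. 0 + 2 * (\<Sum>j<m. s j * g i (w (Suc j))))) \<partial>?P)"
    unfolding e_def by (rule N.symmetrization[OF q gi])
  also have "\<dots> \<le> (\<integral>\<^sup>+w. ennreal (2 powr q) * (ennreal (K * \<tau> powr q * real m powr (q / r - 1)) * (\<Sum>j<m. ennreal ((norm (w (Suc j)) ^ k) powr q))) \<partial>?P)"
    by (intro nn_integral_mono_AE eventually_mono[OF PV] pw)
  also have "\<dots> = ennreal (2 powr q) * (ennreal (K * \<tau> powr q * real m powr (q / r - 1)) * (\<Sum>j<m. ennreal B))"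
  proof -
    have "(\<integral>\<^sup>+w. (\<Sum>j<m. ennreal ((norm (w (Suc j)) ^ k) powr q)) \<partial>?P)
        = (\<Sum>j<m. \<integral>\<^sup>+w. ennreal ((norm (w (Suc j)) ^ k) powr q) \<partial>?P)"
      by (intro nn_integral_sum mm) auto
    also have "\<dots> = (\<Sum>j<m. ennreal B)" by (intro sum.cong comp) auto
    finally have s: "(\<integral>\<^sup>+w. (\<Sum>j<m. ennreal ((norm (w (Suc j)) ^ k) powr q)) \<partial>?P) = (\<Sum>j<m. ennreal B)" .
    have sm: "(\<lambda>w. \<Sum>j<m. ennreal ((norm (w (Suc j)) ^ k) powr q)) \<in> borel_measurable ?P"
      by (intro borel_measurable_sum mm) auto
    show ?thesis unfolding mult.assoc[symmetric] nn_integral_cmult[OF sm] s ..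
  qed
  also have "\<dots> = ennreal (2 powr q * (K * \<tau> powr q * real m powr (q / r - 1) * (real m * B)))"
    using c0 by (simp add: ennreal_mult[symmetric] ennreal_of_nat_eq_real_of_nat B_def)
  finally have main: "(\<integral>\<^sup>+w. ?h w \<partial>?P) \<le> \<dots>" .
  have "sup_pow q (\<lambda>i. (\<integral>v. F i (Y v) ^ k \<partial>M) - (\<Sum>j=1..m. F i (Ys j w) ^ k) / real m)
      = ennreal ((1 / real m) powr q) * ?h (?Y w)" for w
  proof -
    have *: "(\<Sum>j<m. g i (?Y w (Suc j)) - e i) = (\<Sum>j=1..m. F i (Ys j w) ^ k) - real m * e i" for i
    proof -
      have "(\<Sum>j<m. g i (?Y w (Suc j))) = (\<Sum>j<m. F i (Ys (Suc j) w) ^ k)"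
        by (intro sum.cong) (auto simp: g_def)
      also have "\<dots> = (\<Sum>j=1..m. F i (Ys j w) ^ k)"
        using sum.shift_bounds_cl_Suc_ivl[of "\<lambda>j. F i (Ys j w) ^ k" 0 "m - 1"] m
        by (simp add: lessThan_atLeast0 atLeastLessThanSuc_atLeastAtMost[symmetric])
      finally show ?thesis by (simp add: sum_subtractf)
    qed
    \<comment> \<open>The error is -1/m times the centred sum; the absolute value removes the
      sign.\<close>
    have "\<bar>(\<integral>v. F i (Y v) ^ k \<partial>M) - (\<Sum>j=1..m. F i (Ys j w) ^ k) / real m\<bar>
        = \<bar>(1 / real m) * (0 + (\<Sum>j<m. g i (?Y w (Suc j)) - e i))\<bar>" for i
    proof -
      have "a - S / real m = - ((1 / real m) * (0 + (S - real m * a)))" for a S :: real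
        using m by (simp add: field_simps)
      then show ?thesis unfolding * e[symmetric] by (metis abs_minus_cancel)
    qed
    then show ?thesis
      unfolding sup_pow_cmult[of "1 / real m" q, symmetric, simplified] unfolding sup_pow_def by simp
  qed
  then have "(\<integral>\<^sup>+w. sup_pow q (\<lambda>i. (\<integral>v. F i (Y v) ^ k \<partial>M) - (\<Sum>j=1..m. F i (Ys j w) ^ k) / real m) \<partial>M)
      = (\<integral>\<^sup>+w. ennreal ((1 / real m) powr q) * ?h (?Y w) \<partial>M)" by simp
  also have "\<dots> = ennreal ((1 / real m) powr q) * (\<integral>\<^sup>+w. ?h (?Y w) \<partial>M)"
    by (intro nn_integral_cmult measurable_compose[OF Ymm hm])
  also have "(\<integral>\<^sup>+w. ?h (?Y w) \<partial>M) = (\<integral>\<^sup>+w. ?h w \<partial>?P)"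
    unfolding dP[symmetric] using hm by (subst nn_integral_distr[OF Ymm]) (simp_all del: add_0)
  also have "ennreal ((1 / real m) powr q) * (\<integral>\<^sup>+w. ?h w \<partial>?P)
      \<le> ennreal ((1 / real m) powr q) * ennreal (2 powr q * (K * \<tau> powr q * real m powr (q / r - 1) * (real m * B)))"
    by (intro mult_left_mono main) simp
  also have "\<dots> = ennreal ((1 / real m) powr q * (2 powr q * (K * \<tau> powr q * real m powr (q / r - 1) * (real m * B))))"
    by (simp add: ennreal_mult' )
  also have "(1 / real m) powr q * (2 powr q * (K * \<tau> powr q * real m powr (q / r - 1) * (real m * B)))
      = 2 powr q * K * \<tau> powr q * B * real m powr (q / r - q)"
    using m by (simp add: powr_divide powr_diff field_simps)
  finally show ?thesis unfolding K_def B_def .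
qed


section \<open>Error and cost\<close>

text \<open>The supremum over the whole dual ball need not be measurable, so it is bounded by a
  measurable G built from a countable family. At sample points in V, the sample sums and the moments
  for any functional are limits along that family, so G misses no larger value.\<close>

lemma (in prob_space) sampling_error_dominated:
  fixes Y :: "'a \<Rightarrow> 'b::real_normed_vector"
  assumes V: "subspace V" "\<exists>B. finite B \<and> V = span B" and \<tau>: "rad_type_ineq V r \<tau>" "1 \<le> \<tau>"
    and r: "1 \<le> r" "r \<le> 2" "r \<le> q" and m: "1 \<le> m"
    and Y: "Y \<in> borel_measurable M" "AE w in M. Y w \<in> V" "integrable M (\<lambda>w. norm (Y w) powr (real k * q))"
    and Ys: "indep_vars (\<lambda>_. borel) Ys {1::nat..}" "\<And>j. 1 \<le> j \<Longrightarrow> distr M borel (Ys j) = distr M borel Y"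
  obtains G where "G \<in> borel_measurable M"
    "AE w in M. (SUP f\<in>dual_ball. ennreal (\<bar>(\<integral>v. f (Y v) ^ k \<partial>M) - (\<Sum>j=1..m. f (Ys j w) ^ k) / real m\<bar> powr q)) \<le> G w"
    "(\<integral>\<^sup>+w. G w \<partial>M) \<le> ennreal (2 powr q * (2 * (2 powr q * (real k powr q + q powr q * exp 1))) * \<tau> powr q *
        (\<integral>w. norm (Y w) powr (real k * q) \<partial>M) * real m powr (q / r - q))"
proof (cases "k = 0")
  \<comment> \<open>All powers are 1 and the error vanishes identically; the rewriting of norm
    powers used in the other case is for \<open>1 \<le> k\<close>.\<close>
  case True
  have "(SUP f\<in>(dual_ball :: ('b \<Rightarrow> real) set). 0 :: ennreal) \<le> 0" by (rule SUP_least) simp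
  then show ?thesis
    by (intro that[of "\<lambda>_. 0"]) (use True m r in \<open>auto simp: prob_space\<close>)
next
  case False
  then have k: "1 \<le> k" by simp
  have q: "1 \<le> q" using r by simp
  obtain D :: "('b \<Rightarrow> real) set" where D: "countable D" "D \<subseteq> dual_ball" "D \<noteq> {}"
    and dense: "\<And>f. f \<in> dual_ball \<Longrightarrow> \<exists>F. (\<forall>n. F n \<in> D) \<and> (\<forall>x\<in>V. (\<lambda>n::nat. F n x) \<longlonglongrightarrow> f x)"
    using countable_pointwise_dense_dual_ball[OF V(2)] by blast
  define F where "F = from_nat_into D"
  have rF: "range F = D" unfolding F_def by (rule range_from_nat_into[OF D(3,1)])
  have F: "F i \<in> dual_ball" for i using rF D(2) by blast
  have cl: "closed V" by (rule closed_finite_dim[OF V(2)])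
  have Ym: "Ys j \<in> borel_measurable M" if "j \<in> {1..m}" for j
    using Ys(1) that unfolding indep_vars_def by auto
  define err where "err f w = (\<integral>v. f (Y v) ^ k \<partial>M) - (\<Sum>j=1..m. f (Ys j w) ^ k) / real m" for f w
  define G where "G w = sup_pow q (\<lambda>i. err (F i) w)" for w
  have "(\<lambda>w. F i (Ys j w) ^ k) \<in> borel_measurable M" if "j \<in> {1..m}" for i j
    by (intro borel_measurable_power measurable_compose[OF Ym[OF that] borel_measurable_dual_ball[OF F]])
  then have "(\<lambda>w. err (F i) w) \<in> borel_measurable M" for i
    unfolding err_def by (intro borel_measurable_diff borel_measurable_divide borel_measurable_sum) auto
  then have 1: "G \<in> borel_measurable M" unfolding G_def by (intro measurable_sup_pow)
  have "AE w in M. Ys j w \<in> V" if "j \<in> {1..m}" for j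
  proof -
    have "V \<in> sets borel" using cl by (simp add: borel_closed)
    then have "AE x in distr M borel Y. x \<in> V" using Y(2) by (subst AE_distr_iff[OF Y(1)]) auto
    then have "AE x in distr M borel (Ys j). x \<in> V" using that by (subst Ys(2)) auto
    then show ?thesis by (rule AE_distrD[OF Ym[OF that]])
  qed
  then have "AE w in M. \<forall>j\<in>{1..m}. Ys j w \<in> V" by (intro AE_ball_countable') auto
  then have 2: "AE w in M. (SUP f\<in>dual_ball. ennreal (\<bar>err f w\<bar> powr q)) \<le> G w"
  proof (rule eventually_mono)
    fix w assume w: "\<forall>j\<in>{1..m}. Ys j w \<in> V"
    show "(SUP f\<in>dual_ball. ennreal (\<bar>err f w\<bar> powr q)) \<le> G w"
    proof (rule SUP_least)
      fix f :: "'b \<Rightarrow> real" assume f: "f \<in> dual_ball"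
      obtain H where H: "\<And>n. H n \<in> D" "\<And>x. x \<in> V \<Longrightarrow> (\<lambda>n::nat. H n x) \<longlonglongrightarrow> f x"
        using dense[OF f] by blast
      have "(\<lambda>n. \<integral>v. H n (Y v) ^ k \<partial>M) \<longlonglongrightarrow> (\<integral>v. f (Y v) ^ k \<partial>M)"
        using H D(2) f by (intro tendsto_moment[OF Y(1,2) integrable_norm_power[OF Y(1,3) q k]]) auto
      then have "(\<lambda>n. err (H n) w) \<longlonglongrightarrow> err f w"
        unfolding err_def using H(2) w m by (intro tendsto_intros) auto
      then have "(\<lambda>n. \<bar>err (H n) w\<bar> powr q) \<longlonglongrightarrow> \<bar>err f w\<bar> powr q"
        using q by (intro tendsto_powr' tendsto_rabs tendsto_const) auto
      then have l: "(\<lambda>n. ennreal (\<bar>err (H n) w\<bar> powr q)) \<longlonglongrightarrow> ennreal (\<bar>err f w\<bar> powr q)"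
        by (rule tendsto_ennrealI)
      have u: "ennreal (\<bar>err (H n) w\<bar> powr q) \<le> G w" for n
      proof -
        obtain i where "H n = F i" using H(1)[of n] rF by blast
        then show ?thesis
          using sup_pow_upper[of "\<lambda>i. err (F i) w" i q] by (simp add: G_def)
      qed
      show "ennreal (\<bar>err f w\<bar> powr q) \<le> G w"
        by (rule LIMSEQ_le_const2[OF l]) (use u in blast)
    qed
  qed
  have 3: "(\<integral>\<^sup>+w. G w \<partial>M) \<le> ennreal (2 powr q * (2 * (2 powr q * (real k powr q + q powr q * exp 1))) * \<tau> powr q *
        (\<integral>w. norm (Y w) powr (real k * q) \<partial>M) * real m powr (q / r - q))"
    unfolding G_def err_def by (rule sup_pow_sampling_error_le[OF V(1) cl \<tau> r k m Y Ys F])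
  show ?thesis by (rule that[OF 1 2[unfolded err_def] 3])
qed

text \<open>The triangle inequality, for each functional and pointwise in w, followed by (b + c)^q
  <= 2^q (b^q + c^q). Points where G is infinite are trivial. Monotonicity of the integral handles
  the error itself; measurability of G allows the majorant to be split.\<close>

lemma Lq_pow_mc_error_le:
  fixes X Y :: "'w \<Rightarrow> 'a::real_normed_vector"
  assumes q: "1 \<le> q" and b: "0 \<le> b" "moment_dist M k X Y \<le> ennreal b" and M: "prob_space M"
    and G: "G \<in> borel_measurable M"
      "AE w in M. (SUP f\<in>dual_ball. ennreal (\<bar>(\<integral>v. f (Y v) ^ k \<partial>M) - (\<Sum>j=1..m. f (Z j w) ^ k) / real m\<bar> powr q)) \<le> G w"
  shows "Lq_pow M q (mc_error M k X Z m) \<le> ennreal (2 powr q) * (ennreal (b powr q) + (\<integral>\<^sup>+w. G w \<partial>M))"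
proof -
  interpret prob_space M by (rule M)
  have pw: "(if mc_error M k X Z m w = \<top> then \<top> else ennreal ((enn2real (mc_error M k X Z m w)) powr q))
      \<le> ennreal (2 powr q) * (ennreal (b powr q) + G w)"
    if w: "(SUP f\<in>dual_ball. ennreal (\<bar>(\<integral>v. f (Y v) ^ k \<partial>M) - (\<Sum>j=1..m. f (Z j w) ^ k) / real m\<bar> powr q)) \<le> G w" for w
  proof (cases "G w")
    case top
    then show ?thesis by (simp add: ennreal_mult_top)
  next
    case (real u)
    define c where "c = b + u powr (1 / q)"
    have c0: "0 \<le> c" using b by (simp add: c_def)
    have "mc_error M k X Z m w \<le> ennreal c"
      unfolding mc_error_def
    proof (intro SUP_least ennreal_leI)
      fix f :: "'a \<Rightarrow> real" assume f: "f \<in> dual_ball"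
      let ?x = "\<integral>v. f (X v) ^ k \<partial>M" and ?y = "\<integral>v. f (Y v) ^ k \<partial>M" and ?s = "(\<Sum>j=1..m. f (Z j w) ^ k) / real m"
      have "ennreal \<bar>?x - ?y\<bar> \<le> moment_dist M k X Y"
        unfolding moment_dist_def by (rule SUP_upper[OF f])
      then have "ennreal \<bar>?x - ?y\<bar> \<le> ennreal b" using b(2) by (rule order_trans)
      then have 1: "\<bar>?x - ?y\<bar> \<le> b" using b by simp
      have "ennreal (\<bar>?y - ?s\<bar> powr q) \<le> G w"
        by (rule order_trans[OF SUP_upper[OF f] w])
      then have "\<bar>?y - ?s\<bar> powr q \<le> u" using real by simp
      then have "(\<bar>?y - ?s\<bar> powr q) powr (1 / q) \<le> u powr (1 / q)" using q by (intro powr_mono2) auto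
      then have "\<bar>?y - ?s\<bar> \<le> u powr (1 / q)" using q by (simp add: powr_powr)
      with 1 show "\<bar>?x - ?s\<bar> \<le> c" unfolding c_def by linarith
    qed
    then obtain d where d: "mc_error M k X Z m w = ennreal d" "0 \<le> d" "d \<le> c"
      using c0 by (cases "mc_error M k X Z m w") (auto simp: top_unique)
    have "d powr q \<le> c powr q" using d q by (intro powr_mono2) auto
    also have "\<dots> \<le> 2 powr q * (b powr q + (u powr (1 / q)) powr q)"
      unfolding c_def using b q by (intro add_powr_le) auto
    also have "\<dots> = 2 powr q * (b powr q + u)" using q real by (simp add: powr_powr)
    finally have "ennreal (d powr q) \<le> ennreal (2 powr q * (b powr q + u))" by (rule ennreal_leI)
    also have "\<dots> = ennreal (2 powr q) * (ennreal (b powr q) + G w)"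
      using real by (simp add: ennreal_mult)
    finally show ?thesis using d by simp
  qed
  have "Lq_pow M q (mc_error M k X Z m) \<le> (\<integral>\<^sup>+w. ennreal (2 powr q) * (ennreal (b powr q) + G w) \<partial>M)"
    unfolding Lq_pow_def by (intro nn_integral_mono_AE eventually_mono[OF G(2)] pw)
  also have "\<dots> = ennreal (2 powr q) * (ennreal (b powr q) + (\<integral>\<^sup>+w. G w \<partial>M))"
    using G(1) by (simp add: nn_integral_cmult nn_integral_add emeasure_space_1)
  finally show ?thesis .
qed

section \<open>Choice of the level and of the sample size\<close>

text \<open>The least exponent that reaches t overshoots by a factor of at most A;
  \<open>max 1 t\<close> covers t <= 1, where the exponent 0 is taken.\<close>

lemma obtain_power_between:
  fixes A t :: real
  assumes "1 < A"
  obtains L where "t \<le> A ^ L" "A ^ L \<le> A * max 1 t"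
proof -
  obtain n where "t < A ^ n" using real_arch_pow[OF assms] by blast
  then have ex: "\<exists>n. t \<le> A ^ n" by (auto intro: less_imp_le)
  define L where "L = (LEAST n. t \<le> A ^ n)"
  have 1: "t \<le> A ^ L" unfolding L_def using ex by (rule LeastI_ex)
  have "A ^ L \<le> A * max 1 t"
  proof (cases L)
    case 0
    have "1 * 1 \<le> A * max 1 t" using assms by (intro mult_mono) auto
    then show ?thesis using 0 by simp
  next
    case (Suc n)
    then have "\<not> t \<le> A ^ n" unfolding L_def by (metis lessI not_less_Least)
    then have "A ^ n \<le> max 1 t" by linarith
    then show ?thesis using assms Suc by (simp add: mult_left_mono)
  qed
  with 1 show ?thesis using that by blast
qed

text \<open>A power is monotone in one direction or the other, so the endpoint values suffice. The
  exponent \<gamma> + \<beta> met later can have either sign.\<close>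

lemma powr_between_le:
  fixes a b x y :: real
  assumes "0 < a" "a \<le> x" "x \<le> b"
  shows "x powr y \<le> a powr y + b powr y"
proof (cases "0 \<le> y")
  case True
  then have "x powr y \<le> b powr y" using assms by (intro powr_mono2) auto
  then show ?thesis by (simp add: add_increasing)
next
  case False
  then have "x powr y \<le> a powr y" using assms by (intro powr_mono2') auto
  then show ?thesis by (simp add: add_increasing2)
qed

text \<open>The bias fixes the level, with \<open>N L\<close> of order
  \<open>\<epsilon> powr (- 1 / \<alpha>)\<close>, and the sampling error at that level fixes m.
  Rounding m up costs a bounded number of extra samples, which produce the first term of the cost;
  the unrounded number produces the second.\<close>

lemma level_and_sample_size:
  fixes err :: "nat \<Rightarrow> nat \<Rightarrow> ennreal" and N :: "nat \<Rightarrow> nat" and cost \<tau> :: "nat \<Rightarrow> real"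
    and q r' \<alpha> C\<alpha> K \<gamma> C\<gamma> C\<tau> A c1 c2 \<beta> :: real
  assumes q: "1 \<le> q" and r': "0 < r'" and \<alpha>: "0 < \<alpha>" "0 < C\<alpha>" and K: "0 < K" and C\<tau>: "0 \<le> C\<tau>"
    and A: "1 < A" and c: "0 < c1" "0 < c2" and N: "\<And>l. c1 * A ^ l \<le> real (N l)" "\<And>l. real (N l) \<le> c2 * A ^ l"
    and \<tau>: "\<And>l. 1 \<le> \<tau> l" "\<And>l. \<tau> l powr r' \<le> C\<tau> * real (N l) powr \<beta>"
    and cost: "0 < C\<gamma>" "\<And>l. cost l \<le> C\<gamma> * real (N l) powr \<gamma>"
    and err: "\<And>l m. 1 \<le> m \<Longrightarrow>
      err l m \<le> ennreal (2 powr q * ((C\<alpha> * real (N l) powr (- \<alpha>)) powr q + (K * \<tau> l * real m powr (- 1 / r')) powr q))"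
  shows "\<exists>C. \<forall>\<epsilon>::real. 0 < \<epsilon> \<and> \<epsilon> \<le> 1/2 \<longrightarrow>
    (\<exists>L m. 1 \<le> m \<and> err L m < ennreal (\<epsilon> powr q) \<and>
      real m * cost L \<le> C * (\<epsilon> powr (- \<gamma> / \<alpha>) + \<epsilon> powr (- r' - (\<gamma> + \<beta>) / \<alpha>)))"
proof -
  \<comment> \<open>A dimension of at least d1 times \<open>\<epsilon> powr (- 1 / \<alpha>)\<close>
    brings the bias down to \<epsilon> / 8. In \<open>d2\<close>, A is the overshoot of the level,
    and the summand 1 pays for the maximum with 1.\<close>
  define d1 where "d1 = (8 * C\<alpha>) powr (1 / \<alpha>)"
  define d2 where "d2 = c2 * (A * (1 + d1 / c1))"
  define g where "g y = d1 powr y + d2 powr y" for y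
  define C where "C = 2 * C\<gamma> * g \<gamma> + (8 * K) powr r' * C\<tau> * C\<gamma> * g (\<gamma> + \<beta>)"
  have d1: "0 < d1" using \<alpha> by (simp add: d1_def)
  have g0: "0 \<le> g y" for y by (simp add: g_def)
  have "\<exists>L m. 1 \<le> m \<and> err L m < ennreal (\<epsilon> powr q) \<and>
      real m * cost L \<le> C * (\<epsilon> powr (- \<gamma> / \<alpha>) + \<epsilon> powr (- r' - (\<gamma> + \<beta>) / \<alpha>))"
    if \<epsilon>: "0 < \<epsilon>" "\<epsilon> \<le> 1/2" for \<epsilon> :: real
  proof -
    define E where "E = \<epsilon> powr (- 1 / \<alpha>)"
    have E0: "0 < E" using \<epsilon> by (simp add: E_def)
    have "1 powr (- 1 / \<alpha>) \<le> \<epsilon> powr (- 1 / \<alpha>)" using \<epsilon> \<alpha> by (intro powr_mono2') auto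
    then have E1: "1 \<le> E" by (simp add: E_def)
    have Ey: "E powr y = \<epsilon> powr (- y / \<alpha>)" for y by (simp add: E_def powr_powr)
    obtain L where L: "d1 * E / c1 \<le> A ^ L" "A ^ L \<le> A * max 1 (d1 * E / c1)"
      using obtain_power_between[OF A] .
    have lo: "d1 * E \<le> real (N L)" using L(1) N(1)[of L] c by (simp add: field_simps)
    have "max 1 (d1 * E / c1) \<le> (1 + d1 / c1) * E"
      using E1 d1 c by (auto simp: max_def distrib_right add_increasing2)
    then have "A ^ L \<le> A * ((1 + d1 / c1) * E)"
      using L(2) A by (meson less_eq_real_def mult_left_mono order_trans zero_less_one)
    then have "c2 * A ^ L \<le> c2 * (A * ((1 + d1 / c1) * E))" using c by (intro mult_left_mono) auto
    then have hi: "real (N L) \<le> d2 * E" using N(2)[of L] by (simp add: d2_def mult.assoc)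
    have N0: "0 < real (N L)" using lo d1 E0 by (smt (verit) mult_pos_pos)
    have Ny: "real (N L) powr y \<le> g y * \<epsilon> powr (- y / \<alpha>)" for y
    proof -
      have d2: "0 \<le> d2" using c A d1 by (simp add: d2_def)
      have "real (N L) powr y \<le> (d1 * E) powr y + (d2 * E) powr y"
        using d1 E0 lo hi by (intro powr_between_le) auto
      also have "\<dots> = g y * E powr y" using d1 d2 E0 by (simp add: powr_mult g_def distrib_right)
      finally show ?thesis unfolding Ey .
    qed
    have bias: "C\<alpha> * real (N L) powr (- \<alpha>) \<le> \<epsilon> / 8"
    proof -
      have "real (N L) powr (- \<alpha>) \<le> (d1 * E) powr (- \<alpha>)"
        using d1 E0 lo \<alpha> by (intro powr_mono2') auto
      also have "\<dots> = d1 powr (- \<alpha>) * E powr (- \<alpha>)" using d1 E0 by (simp add: powr_mult)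
      also have "d1 powr (- \<alpha>) = 1 / (8 * C\<alpha>)" using \<alpha> by (simp add: d1_def powr_powr powr_minus_divide)
      also have "E powr (- \<alpha>) = \<epsilon>" using \<alpha> \<epsilon> unfolding Ey by simp
      finally show ?thesis using \<alpha> by (simp add: field_simps)
    qed
    define T where "T = 8 * K * \<tau> L / \<epsilon>"
    have T0: "0 < T" using K \<tau>(1)[of L] \<epsilon> by (simp add: T_def)
    \<comment> \<open>\<open>T powr r'\<close> samples bring the sampling error down to \<epsilon> /
      8. The added 1 ensures \<open>1 \<le> m\<close>; together with the ceiling it costs at most
      2.\<close>
    define m where "m = nat \<lceil>T powr r'\<rceil> + 1"
    have m1: "1 \<le> m" by (simp add: m_def)
    have mlo: "T powr r' \<le> real m" and mhi: "real m \<le> T powr r' + 2"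
      unfolding m_def using powr_ge_zero[of T r'] by linarith+
    have var: "K * \<tau> L * real m powr (- 1 / r') \<le> \<epsilon> / 8"
    proof -
      have "real m powr (- 1 / r') \<le> (T powr r') powr (- 1 / r')"
        using mlo T0 r' by (intro powr_mono2') auto
      also have "\<dots> = 1 / T" using T0 r' by (simp add: powr_powr powr_minus_divide)
      finally have "K * \<tau> L * real m powr (- 1 / r') \<le> K * \<tau> L * (1 / T)"
        using K \<tau>(1)[of L] by (intro mult_left_mono) auto
      also have "\<dots> = \<epsilon> / 8" using K \<tau>(1)[of L] \<epsilon> by (simp add: T_def)
      finally show ?thesis .
    qed
    \<comment> \<open>The origin of the 8: two errors of \<epsilon> / 8 combine to 2 (\<epsilon> /
      4)^q, strictly below \<epsilon>^q because 2 < 4 <= 4^q.\<close>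
    have "2 powr q * ((C\<alpha> * real (N L) powr (- \<alpha>)) powr q + (K * \<tau> L * real m powr (- 1 / r')) powr q)
        \<le> 2 powr q * ((\<epsilon> / 8) powr q + (\<epsilon> / 8) powr q)"
      using bias var q \<alpha> K \<tau>(1)[of L] by (intro mult_left_mono add_mono powr_mono2) auto
    also have "\<dots> = 2 * (2 * (\<epsilon> / 8)) powr q" using \<epsilon> by (subst powr_mult) auto
    also have "\<dots> = 2 * (\<epsilon> powr q / 4 powr q)" using \<epsilon> by (simp add: powr_divide)
    also have "\<dots> < \<epsilon> powr q"
    proof -
      have "4 powr 1 \<le> 4 powr q" using q by (intro powr_mono) auto
      then have "4 \<le> 4 powr q" by simp
      then have "2 * \<epsilon> powr q < 4 powr q * \<epsilon> powr q"
        using \<epsilon> by (intro mult_strict_right_mono) auto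
      then show ?thesis by (simp add: field_simps)
    qed
    finally have "err L m < ennreal (\<epsilon> powr q)"
      using err[OF m1, of L] by (elim order_le_less_trans) (simp add: ennreal_less_iff)
    moreover have "real m * cost L \<le> C * (\<epsilon> powr (- \<gamma> / \<alpha>) + \<epsilon> powr (- r' - (\<gamma> + \<beta>) / \<alpha>))"
    proof -
      have "T powr r' = (8 * K) powr r' * \<tau> L powr r' * \<epsilon> powr (- r')"
        unfolding T_def using K \<tau>(1)[of L] \<epsilon> by (simp add: powr_mult powr_divide powr_minus_divide)
      also have "\<dots> \<le> (8 * K) powr r' * (C\<tau> * real (N L) powr \<beta>) * \<epsilon> powr (- r')"
        using \<tau>(2)[of L] by (intro mult_right_mono mult_left_mono) auto
      finally have T: "T powr r' \<le> (8 * K) powr r' * (C\<tau> * real (N L) powr \<beta>) * \<epsilon> powr (- r')" .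
      have "real m * cost L \<le> real m * (C\<gamma> * real (N L) powr \<gamma>)"
        using cost(2) by (intro mult_left_mono) auto
      also have "\<dots> \<le> ((8 * K) powr r' * (C\<tau> * real (N L) powr \<beta>) * \<epsilon> powr (- r') + 2) * (C\<gamma> * real (N L) powr \<gamma>)"
        using mhi T cost(1) by (intro mult_right_mono) auto
      also have "\<dots> = 2 * C\<gamma> * real (N L) powr \<gamma>
          + (8 * K) powr r' * C\<tau> * C\<gamma> * \<epsilon> powr (- r') * real (N L) powr (\<gamma> + \<beta>)"
        by (simp add: powr_add algebra_simps)
      also have "\<dots> \<le> 2 * C\<gamma> * (g \<gamma> * \<epsilon> powr (- \<gamma> / \<alpha>))
          + (8 * K) powr r' * C\<tau> * C\<gamma> * \<epsilon> powr (- r') * (g (\<gamma> + \<beta>) * \<epsilon> powr (- (\<gamma> + \<beta>) / \<alpha>))"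
        using cost(1) C\<tau> by (intro add_mono mult_left_mono Ny) auto
      also have "\<dots> = (2 * C\<gamma> * g \<gamma>) * \<epsilon> powr (- \<gamma> / \<alpha>)
          + ((8 * K) powr r' * C\<tau> * C\<gamma> * g (\<gamma> + \<beta>)) * \<epsilon> powr (- r' - (\<gamma> + \<beta>) / \<alpha>)"
      proof -
        have "\<epsilon> powr (- r' - (\<gamma> + \<beta>) / \<alpha>) = \<epsilon> powr (- r') * \<epsilon> powr (- (\<gamma> + \<beta>) / \<alpha>)"
          unfolding powr_add[symmetric] minus_divide_left[symmetric] by (simp only: diff_conv_add_uminus)
        then show ?thesis by simp
      qed
      also have "\<dots> \<le> C * \<epsilon> powr (- \<gamma> / \<alpha>) + C * \<epsilon> powr (- r' - (\<gamma> + \<beta>) / \<alpha>)"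
        unfolding C_def using cost(1) C\<tau> g0 by (intro add_mono mult_right_mono) auto
      finally show ?thesis by (simp only: distrib_left)
    qed
    ultimately show ?thesis using m1 by blast
  qed
  then show ?thesis by blast
qed


theorem mainTheorem6:
  fixes M :: "'w measure"
    and X :: "'w \<Rightarrow> 'a::banach"
    and Xl :: "nat \<Rightarrow> 'w \<Rightarrow> 'a"
    and Xs :: "nat \<Rightarrow> nat \<Rightarrow> 'w \<Rightarrow> 'a"
    and El :: "nat \<Rightarrow> 'a set"
    and N :: "nat \<Rightarrow> nat"
    and cost :: "nat \<Rightarrow> real"
    and k :: nat
    and p q a0 a1 C\<tau> \<alpha> C\<alpha> Cstab \<gamma> C\<gamma> A :: real
  assumes M: "prob_space M"
    and p: "1 \<le> p" "p \<le> 2" and Etype: "has_rad_type (UNIV :: 'a set) p"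
    and q: "1 < q" "p \<le> q"
    and X_meas: "X \<in> borel_measurable M"
    and X_Lk: "integrable M (\<lambda>w. norm (X w) ^ k)"
    and El_sub: "\<And>l. subspace (El l)"
    and El_fin: "\<And>l. \<exists>B. finite B \<and> El l = span B"
    and El_dim: "\<And>l. dim (El l) = N l"
    and a: "0 \<le> a0" "0 \<le> a1" "1 \<le> C\<tau>"
    and growth: "\<And>l r. p \<le> r \<Longrightarrow> r \<le> 2 \<Longrightarrow> 1 < r \<Longrightarrow>
        real (N l) powr (- (a0 - a1 * hconj r)) * rad_type_const (El l) r powr (hconj r) \<le> C\<tau>"
    and Xl_meas: "\<And>l. Xl l \<in> borel_measurable M"
    and Xl_val: "\<And>l. AE w in M. Xl l w \<in> El l"
    and Xl_Lkq: "\<And>l. integrable M (\<lambda>w. norm (Xl l w) powr (real k * q))"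
    and Xs_indep: "\<And>l. prob_space.indep_vars M (\<lambda>_. borel) (Xs l) {1..}"
    and Xs_distr: "\<And>l j. 1 \<le> j \<Longrightarrow> distr M borel (Xs l j) = distr M borel (Xl l)"
    and \<alpha>: "0 < \<alpha>" "0 < C\<alpha>" "0 < Cstab"
    and bias: "\<And>l. ennreal (real (N l) powr \<alpha>) * moment_dist M k X (Xl l) \<le> ennreal C\<alpha>"
    and stab: "\<And>l. (\<integral>w. norm (Xl l w) powr (real k * q) \<partial>M) powr (1 / q) \<le> Cstab"
    and cost: "0 < \<gamma>" "0 < C\<gamma>" "\<And>l. cost l \<le> C\<gamma> * real (N l) powr \<gamma>"
    and A: "1 < A"
    and N_growth: "\<exists>c1 c2. 0 < c1 \<and> 0 < c2 \<and> (\<forall>l. c1 * A ^ l \<le> real (N l) \<and> real (N l) \<le> c2 * A ^ l)"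
  shows
    "(\<forall>\<epsilon>::real. 0 < \<epsilon> \<and> \<epsilon> \<le> 1/2 \<longrightarrow>
        (\<exists>L m. 1 \<le> m \<and> Lq_pow M q (mc_error M k X (Xs L) m) < ennreal (\<epsilon> powr q)))
     \<and> (a1 \<le> \<alpha> \<longrightarrow>
        (\<exists>C. \<forall>\<epsilon>::real. 0 < \<epsilon> \<and> \<epsilon> \<le> 1/2 \<longrightarrow>
          (\<exists>L m. 1 \<le> m \<and> Lq_pow M q (mc_error M k X (Xs L) m) < ennreal (\<epsilon> powr q) \<and>
             real m * cost L \<le> C * (\<epsilon> powr (- \<gamma> / \<alpha>)
               + \<epsilon> powr (- hconj (min q 2) - (\<gamma> + a0 - a1 * hconj (min q 2)) / \<alpha>)))))
     \<and> (\<alpha> < a1 \<and> 1 < p \<longrightarrow>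
        (\<exists>C. \<forall>\<epsilon>::real. 0 < \<epsilon> \<and> \<epsilon> \<le> 1/2 \<longrightarrow>
          (\<exists>L m. 1 \<le> m \<and> Lq_pow M q (mc_error M k X (Xs L) m) < ennreal (\<epsilon> powr q) \<and>
             real m * cost L \<le> C * (\<epsilon> powr (- \<gamma> / \<alpha>)
               + \<epsilon> powr (- hconj p - (\<gamma> + a0 - a1 * hconj p) / \<alpha>)))))"
proof -
  interpret prob_space M by (rule M)
  obtain c1 c2 where c: "0 < c1" "0 < c2"
    and Nb: "\<And>l. c1 * A ^ l \<le> real (N l)" "\<And>l. real (N l) \<le> c2 * A ^ l"
    using N_growth by blast
  have N0: "0 < real (N l)" for l
    using Nb(1)[of l] c A by (meson less_le_trans mult_pos_pos zero_less_one order_less_trans zero_less_power)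
  have key: "\<exists>C. \<forall>\<epsilon>::real. 0 < \<epsilon> \<and> \<epsilon> \<le> 1/2 \<longrightarrow>
      (\<exists>L m. 1 \<le> m \<and> Lq_pow M q (mc_error M k X (Xs L) m) < ennreal (\<epsilon> powr q) \<and>
        real m * cost L \<le> C * (\<epsilon> powr (- \<gamma> / \<alpha>) + \<epsilon> powr (- hconj r - (\<gamma> + a0 - a1 * hconj r) / \<alpha>)))"
    if r: "1 < r" "p \<le> r" "r \<le> 2" "r \<le> q" for r
  proof -
    define r' where "r' = hconj r"
    have r'0: "0 < r'" and r'i: "- 1 / r' = 1 / r - 1"
      using r by (simp_all add: r'_def hconj_def field_simps)
    define \<tau> where "\<tau> l = rad_type_const (El l) r" for l
    define K1 where "K1 = 2 powr q * (2 * (2 powr q * (real k powr q + q powr q * exp 1)))"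
    \<comment> \<open>The q-th root makes the sampling bound exactly the q-th power of
      \<open>K * \<tau> l * real m powr (- 1 / r')\<close>.\<close>
    define K where "K = K1 powr (1 / q) * Cstab"
    have "0 < q powr q * exp 1" using q by simp
    then have "0 < real k powr q + q powr q * exp 1" by (intro add_nonneg_pos) auto
    then have K1: "0 < K1" unfolding K1_def by simp
    have type: "rad_type_ineq (El l) r (\<tau> l)" for l
      unfolding \<tau>_def using r El_fin[of l]
      by (intro rad_type_ineq_rad_type_const has_rad_type_finite_dim) auto
    \<comment> \<open>\<open>El l\<close> contains a nonzero vector because its dimension
      \<open>N l\<close> is positive; the zero space would have type constant 0.\<close>
    have \<tau>1: "1 \<le> \<tau> l" for l
    proof -
      have "\<exists>x\<in>El l. x \<noteq> 0"
      proof (rule ccontr)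
        assume "\<not> (\<exists>x\<in>El l. x \<noteq> 0)"
        then have "El l = {0}" using El_sub[of l] subspace_0 by blast
        then have "dim (El l) = dim (span {} :: 'a set)" by simp
        also have "\<dots> = 0" by (simp only: dim_span dim_eq_card_independent[OF independent_empty] card.empty)
        finally show False using El_dim[of l] N0[of l] by simp
      qed
      then show ?thesis using rad_type_ineq_ge_1[OF type] r by fastforce
    qed
    have \<tau>2: "\<tau> l powr r' \<le> C\<tau> * real (N l) powr (a0 - a1 * r')" for l
    proof -
      have "real (N l) powr (- (a0 - a1 * r')) * \<tau> l powr r' \<le> C\<tau>"
        unfolding \<tau>_def r'_def by (rule growth[OF r(2,3,1)])
      then show ?thesis using N0[of l] unfolding powr_minus_divide by (simp add: field_simps)
    qed
    have err: "Lq_pow M q (mc_error M k X (Xs l) m) \<le>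
        ennreal (2 powr q * ((C\<alpha> * real (N l) powr (- \<alpha>)) powr q + (K * \<tau> l * real m powr (- 1 / r')) powr q))"
      if m: "1 \<le> m" for l m
    proof -
      define b where "b = C\<alpha> * real (N l) powr (- \<alpha>)"
      define B where "B = (\<integral>w. norm (Xl l w) powr (real k * q) \<partial>M)"
      have b0: "0 \<le> b" using \<alpha> by (simp add: b_def)
      have B0: "0 \<le> B" by (simp add: B_def)
      \<comment> \<open>Division of the bias assumption by the power of \<open>N l\<close> is
        carried out as multiplication by the inverse power.\<close>
      have "ennreal (real (N l) powr (- \<alpha>)) * ennreal (real (N l) powr \<alpha>) = 1"
        using N0[of l] by (simp add: ennreal_mult[symmetric] powr_add[symmetric])
      then have "moment_dist M k X (Xl l)
          = ennreal (real (N l) powr (- \<alpha>)) * (ennreal (real (N l) powr \<alpha>) * moment_dist M k X (Xl l))"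
        unfolding mult.assoc[symmetric] by simp
      also have "\<dots> \<le> ennreal (real (N l) powr (- \<alpha>)) * ennreal C\<alpha>"
        by (intro mult_left_mono bias) simp
      also have "\<dots> = ennreal b"
        unfolding b_def mult.commute[of C\<alpha>] using \<alpha> by (intro ennreal_mult[symmetric]) auto
      finally have bd: "moment_dist M k X (Xl l) \<le> ennreal b" .
      have r1: "1 \<le> r" using r by simp
      obtain G where G: "G \<in> borel_measurable M"
        "AE w in M. (SUP f\<in>dual_ball. ennreal (\<bar>(\<integral>v. f (Xl l v) ^ k \<partial>M) - (\<Sum>j=1..m. f (Xs l j w) ^ k) / real m\<bar> powr q)) \<le> G w"
        "(\<integral>\<^sup>+w. G w \<partial>M) \<le> ennreal (K1 * \<tau> l powr q * B * real m powr (q / r - q))"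
        using sampling_error_dominated[OF El_sub El_fin type \<tau>1 r1 r(3,4) m Xl_meas Xl_val Xl_Lkq Xs_indep Xs_distr]
        unfolding K1_def B_def by blast
      have "(B powr (1 / q)) powr q \<le> Cstab powr q"
        using stab[of l] q unfolding B_def by (intro powr_mono2) auto
      then have BC: "B \<le> Cstab powr q" using B0 q by (simp add: powr_powr)
      have "K1 * \<tau> l powr q * B * real m powr (q / r - q) \<le> K1 * \<tau> l powr q * Cstab powr q * real m powr (q / r - q)"
        using BC K1 by (intro mult_right_mono mult_left_mono) auto
      also have "\<dots> = (K * \<tau> l * real m powr (- 1 / r')) powr q"
      proof -
        have "(1 / r - 1) * q = q / r - q" by (simp add: field_simps)
        then show ?thesis
          using K1 \<alpha> \<tau>1[of l] q unfolding r'i K_def by (simp add: powr_mult powr_powr)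
      qed
      finally have S: "(\<integral>\<^sup>+w. G w \<partial>M) \<le> ennreal ((K * \<tau> l * real m powr (- 1 / r')) powr q)"
        by (intro order_trans[OF G(3)] ennreal_leI)
      have "Lq_pow M q (mc_error M k X (Xs l) m) \<le> ennreal (2 powr q) * (ennreal (b powr q) + (\<integral>\<^sup>+w. G w \<partial>M))"
        using q by (intro Lq_pow_mc_error_le[OF _ b0 bd M G(1,2)]) auto
      also have "\<dots> \<le> ennreal (2 powr q) * (ennreal (b powr q) + ennreal ((K * \<tau> l * real m powr (- 1 / r')) powr q))"
        by (intro mult_left_mono add_left_mono S) simp
      also have "\<dots> = ennreal (2 powr q * (b powr q + (K * \<tau> l * real m powr (- 1 / r')) powr q))"
        by (simp add: ennreal_mult)
      finally show ?thesis unfolding b_def .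
    qed
    have q1: "1 \<le> q" and C0: "0 \<le> C\<tau>" and K0: "0 < K"
      using q a K1 \<alpha> by (simp_all add: K_def)
    show ?thesis
      using level_and_sample_size[OF q1 r'0 \<alpha>(1,2) K0 C0 A c Nb \<tau>1 \<tau>2 cost(2,3) err]
      unfolding r'_def add_diff_eq .
  qed
  \<comment> \<open>Up to sign, the second exponent of the cost is r' (1 - a1 / \<alpha>) +
    (\<gamma> + a0) / \<alpha>. For a1 <= \<alpha> it is nondecreasing in r', so the smallest r' is
    best, that is the largest admissible r, \<open>min q 2\<close>; for \<alpha> < a1 it decreases,
    and the largest r', at r = p, is best.\<close>
  have 2: "\<exists>C. \<forall>\<epsilon>::real. 0 < \<epsilon> \<and> \<epsilon> \<le> 1/2 \<longrightarrow>
      (\<exists>L m. 1 \<le> m \<and> Lq_pow M q (mc_error M k X (Xs L) m) < ennreal (\<epsilon> powr q) \<and>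
        real m * cost L \<le> C * (\<epsilon> powr (- \<gamma> / \<alpha>)
          + \<epsilon> powr (- hconj (min q 2) - (\<gamma> + a0 - a1 * hconj (min q 2)) / \<alpha>)))"
    using p q by (intro key) auto
  have 3: "\<exists>C. \<forall>\<epsilon>::real. 0 < \<epsilon> \<and> \<epsilon> \<le> 1/2 \<longrightarrow>
      (\<exists>L m. 1 \<le> m \<and> Lq_pow M q (mc_error M k X (Xs L) m) < ennreal (\<epsilon> powr q) \<and>
        real m * cost L \<le> C * (\<epsilon> powr (- \<gamma> / \<alpha>) + \<epsilon> powr (- hconj p - (\<gamma> + a0 - a1 * hconj p) / \<alpha>)))"
    if "1 < p"
    using p q that by (intro key) auto
  show ?thesis using 2 3 by blast
qed

end
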